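(* Given $m$ strings $s_1,\dots,s_m$, each of length $n$, a set $S\subseteq[n]$ and a parameter $0\le d\le n$, there is an algorithm that computes a common alignment $\sigma_n$ of $s_1,\dots,s_m$ such that $\sum_{k\in[m]}|\bar{\sigma}_n(s_k)|\le dm$ and $|\bar{\sigma}_n(s_1)\cap S|$ is maximized (among such alignments), in time $\tilde{O}(2^m m n^{m+1})$.
   Context: A common alignment (common subsequence) $\sigma$ of $s_1,\dots,s_m$ is a sequence together with an embedding of it as a subsequence into each $s_j$; $\sigma(s_j)\subseteq[n]$ denotes the set of indices of characters of $s_j$ used (aligned) by the embedding and $\bar{\sigma}(s_j)=[n]\setminus\sigma(s_j)$ the set of unaligned indices. The quantity $\sum_{k}|\bar{\sigma}(s_k)|$ is the cumulative alignment cost. $\tilde{O}$ hides polylogarithmic factors. *)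

theory Defs
  imports Complex_Main
begin

section \<open>Common alignments\<close>

text \<open>
  Positions are counted from 0, so the index set [n] is \<open>{..<n}\<close> and the string s_1 is \<open>ss ! 0\<close>.
  An alignment is a pair of a sequence and a list of embeddings, the k-th of which lists in
  increasing order the positions of \<open>ss ! k\<close> to which the successive characters are mapped.
\<close>

type_synonym 'a alignment = "'a list \<times> nat list list"

definition embedding :: "'a list \<Rightarrow> 'a list \<Rightarrow> nat list \<Rightarrow> bool" where
  "embedding t s e \<longleftrightarrow>
     length e = length t \<and> sorted_wrt (<) e \<and>
     (\<forall>i<length t. e ! i < length s \<and> s ! (e ! i) = t ! i)"

definition common_alignment :: "'a list list \<Rightarrow> 'a alignment \<Rightarrow> bool" where
  "common_alignment ss \<sigma> \<longleftrightarrow>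
     length (snd \<sigma>) = length ss \<and>
     (\<forall>k<length ss. embedding (fst \<sigma>) (ss ! k) (snd \<sigma> ! k))"

definition aligned :: "'a alignment \<Rightarrow> nat \<Rightarrow> nat set" where
  "aligned \<sigma> k = set (snd \<sigma> ! k)"

definition unaligned :: "'a list list \<Rightarrow> 'a alignment \<Rightarrow> nat \<Rightarrow> nat set" where
  "unaligned ss \<sigma> k = {..<length (ss ! k)} - aligned \<sigma> k"

definition alignment_cost :: "'a list list \<Rightarrow> 'a alignment \<Rightarrow> nat" where
  "alignment_cost ss \<sigma> = (\<Sum>k<length ss. card (unaligned ss \<sigma> k))"


section \<open>Word RAM\<close>

text \<open>
  Words are the naturals below \<open>2 ^ w\<close>. A program uses finitely many registers and a random access
  memory, both holding words. Constants, sums and products are reduced modulo \<open>2 ^ w\<close>,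
  subtraction is truncated at 0, and comparisons return 0 or 1.
  Every instruction and every evaluation of a branch or loop condition takes one time unit.
\<close>

datatype binop = Add | Sub | Mul | Quot | Rem | Less | Equal

datatype com =
    Skip
  | Const nat nat
  | Op binop nat nat nat
  | Load nat nat
  | Store nat nat
  | Seq com com
  | IfNZ nat com com
  | WhileNZ nat com

record ram =
  reg :: "nat \<Rightarrow> nat"
  mem :: "nat \<Rightarrow> nat"

fun binop_val :: "nat \<Rightarrow> binop \<Rightarrow> nat \<Rightarrow> nat \<Rightarrow> nat" where
  "binop_val w Add x y = (x + y) mod 2 ^ w"
| "binop_val w Sub x y = x - y"
| "binop_val w Mul x y = (x * y) mod 2 ^ w"
| "binop_val w Quot x y = x div y"
| "binop_val w Rem x y = x mod y"
| "binop_val w Less x y = of_bool (x < y)"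
| "binop_val w Equal x y = of_bool (x = y)"

text \<open>
  \<open>exec w P st t st'\<close>: with word length \<open>w\<close>, program \<open>P\<close> started in \<open>st\<close> halts in \<open>st'\<close> after
  exactly \<open>t\<close> time units.
\<close>

inductive exec :: "nat \<Rightarrow> com \<Rightarrow> ram \<Rightarrow> nat \<Rightarrow> ram \<Rightarrow> bool" for w :: nat where
  exec_Skip: "exec w Skip st 1 st"
| exec_Const: "exec w (Const r v) st 1 (st\<lparr>reg := (reg st)(r := v mod 2 ^ w)\<rparr>)"
| exec_Op: "exec w (Op f r a b) st 1
    (st\<lparr>reg := (reg st)(r := binop_val w f (reg st a) (reg st b))\<rparr>)"
| exec_Load: "exec w (Load r a) st 1 (st\<lparr>reg := (reg st)(r := mem st (reg st a))\<rparr>)"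
| exec_Store: "exec w (Store a r) st 1 (st\<lparr>mem := (mem st)(reg st a := reg st r)\<rparr>)"
| exec_Seq: "exec w P st t st' \<Longrightarrow> exec w Q st' u st'' \<Longrightarrow> exec w (Seq P Q) st (t + u) st''"
| exec_If_true: "reg st r \<noteq> 0 \<Longrightarrow> exec w P st t st' \<Longrightarrow> exec w (IfNZ r P Q) st (1 + t) st'"
| exec_If_false: "reg st r = 0 \<Longrightarrow> exec w Q st t st' \<Longrightarrow> exec w (IfNZ r P Q) st (1 + t) st'"
| exec_While_stop: "reg st r = 0 \<Longrightarrow> exec w (WhileNZ r P) st 1 st"
| exec_While_step: "reg st r \<noteq> 0 \<Longrightarrow> exec w P st t st' \<Longrightarrow> exec w (WhileNZ r P) st' u st'' \<Longrightarrow>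
    exec w (WhileNZ r P) st (1 + t + u) st''"

inductive_cases exec_SkipE: "exec w Skip st t st'"
inductive_cases exec_ConstE: "exec w (Const r v) st t st'"
inductive_cases exec_OpE: "exec w (Op f r a b) st t st'"
inductive_cases exec_LoadE: "exec w (Load r a) st t st'"
inductive_cases exec_StoreE: "exec w (Store a r) st t st'"
inductive_cases exec_SeqE: "exec w (Seq P Q) st t st'"
inductive_cases exec_IfE: "exec w (IfNZ r P Q) st t st'"
inductive_cases exec_WhileE: "exec w (WhileNZ r P) st t st'"

lemma exec_deterministic:
  "exec w P st t st' \<Longrightarrow> exec w P st u st'' \<Longrightarrow> u = t \<and> st'' = st'"
proof (induction arbitrary: u st'' rule: exec.induct)
  case (exec_Seq P st t st' Q u' st3)
  from exec_Seq.prems obtain t1 t2 st1 where "exec w P st t1 st1" "exec w Q st1 t2 st''" "u = t1 + t2"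
    by (rule exec_SeqE)
  with exec_Seq.IH show ?case by metis
next
  case (exec_If_true st r P t st' Q)
  from exec_If_true.prems exec_If_true.hyps obtain t1 where "exec w P st t1 st''" "u = 1 + t1"
    by (auto elim: exec_IfE)
  with exec_If_true.IH show ?case by metis
next
  case (exec_If_false st r Q t st' P)
  from exec_If_false.prems exec_If_false.hyps obtain t1 where "exec w Q st t1 st''" "u = 1 + t1"
    by (auto elim: exec_IfE)
  with exec_If_false.IH show ?case by metis
next
  case (exec_While_stop st r P)
  from exec_While_stop.prems exec_While_stop.hyps show ?case
    by (auto elim: exec_WhileE)
next
  case (exec_While_step st r P t st' u' st3)
  from exec_While_step.prems exec_While_step.hyps obtain t1 t2 st1
    where "exec w P st t1 st1" "exec w (WhileNZ r P) st1 t2 st''" "u = 1 + t1 + t2"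
    by (auto elim: exec_WhileE)
  with exec_While_step.IH show ?case by metis
qed (auto elim: exec_SkipE exec_ConstE exec_OpE exec_LoadE exec_StoreE)


section \<open>Input and output format\<close>

text \<open>
  The memory initially holds \<open>m\<close>, \<open>n\<close>, \<open>d\<close>, the characteristic vector of \<open>S\<close> and the strings one
  after the other; everything else is 0.
\<close>

definition input_words :: "nat \<Rightarrow> nat list list \<Rightarrow> nat set \<Rightarrow> nat \<Rightarrow> nat list" where
  "input_words n ss S d =
     [length ss, n, d] @ map (\<lambda>i. of_bool (i \<in> S)) [0..<n] @ concat ss"

definition input_state :: "nat \<Rightarrow> nat list list \<Rightarrow> nat set \<Rightarrow> nat \<Rightarrow> ram" where
  "input_state n ss S d =
     (let xs = input_words n ss S d
      in \<lparr>reg = (\<lambda>_. 0), mem = (\<lambda>a. if a < length xs then xs ! a else 0)\<rparr>)"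

text \<open>
  On halting, register 0 holds the length of the common sequence and register 1 the address of a
  memory block that contains this sequence followed by its embeddings. For a common alignment all
  these lists have the same length, so the block determines the alignment.
\<close>

definition outputs :: "ram \<Rightarrow> nat alignment \<Rightarrow> bool" where
  "outputs st \<sigma> \<longleftrightarrow>
     (let xs = fst \<sigma> @ concat (snd \<sigma>)
      in reg st 0 = length (fst \<sigma>) \<and>
         map (mem st) [reg st 1..<reg st 1 + length xs] = xs)"

end

theory Submission
  imports Defs
begin

text \<open>
  All strings have length \<open>n\<close>, so an alignment of length \<open>l\<close> costs \<open>m * (n - l)\<close>, and the cost constraint
  says \<open>l \<ge> L\<close> for \<open>L = n - d\<close>. Truncation never aligns more positions of \<open>S\<close>, so it suffices to minimise
  the number of aligned positions of \<open>S\<close> over alignments of length exactly \<open>L\<close>.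

  This is a dynamic program over the pairs of a length \<open>l\<close> and a tuple of prefix lengths. The tuple is
  encoded by a number below \<open>N = (n + 1) ^ m\<close>, its digits to the base \<open>n + 1\<close>, and the pair by
  \<open>p = l * N + idx\<close>; shortening the prefix of string \<open>k\<close> subtracts \<open>(n + 1) ^ k\<close>, and removing a column
  subtracts \<open>N + (\<Sum>k<m. (n + 1) ^ k)\<close>. An entry stores \<open>weight * N + idx'\<close>, where \<open>idx'\<close> is the cell of
  the last aligned column. Minimising entries thus minimises weights and carries along the
  pointers that are followed when an optimal alignment is read off.

  Each of the at most \<open>(n + 1) ^ (m + 1) \<le> 2 ^ (m + 1) * n ^ (m + 1)\<close> entries takes time \<open>O(m)\<close>.
\<close>

section \<open>Straight-line code and counting loops\<close>

definition runs :: "nat \<Rightarrow> com \<Rightarrow> (nat \<Rightarrow> nat) \<Rightarrow> (nat \<Rightarrow> nat) \<Rightarrow> nat \<Rightarrow>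
    ((nat \<Rightarrow> nat) \<Rightarrow> (nat \<Rightarrow> nat) \<Rightarrow> bool) \<Rightarrow> bool" where
  "runs w P g M b Q \<longleftrightarrow>
     (\<exists>t g' M'. exec w P \<lparr>reg = g, mem = M\<rparr> t \<lparr>reg = g', mem = M'\<rparr> \<and> t \<le> b \<and> Q g' M')"

lemma runs_weaken:
  assumes "runs w P g M b Q" "b \<le> b'" "\<And>g M. Q g M \<Longrightarrow> Q' g M"
  shows "runs w P g M b' Q'"
  using assms unfolding runs_def by (meson order_trans)

lemma runs_Seq:
  assumes "runs w P g M b Q" "\<And>g M. Q g M \<Longrightarrow> runs w P' g M b' Q'"
  shows "runs w (Seq P P') g M (b + b') Q'"
proof -
  obtain t g1 M1 where 1: "exec w P \<lparr>reg = g, mem = M\<rparr> t \<lparr>reg = g1, mem = M1\<rparr>" "t \<le> b" "Q g1 M1"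
    using assms(1) unfolding runs_def by blast
  obtain u g2 M2 where 2: "exec w P' \<lparr>reg = g1, mem = M1\<rparr> u \<lparr>reg = g2, mem = M2\<rparr>" "u \<le> b'" "Q' g2 M2"
    using assms(2)[OF 1(3)] unfolding runs_def by blast
  show ?thesis unfolding runs_def
    using exec_Seq[OF 1(1) 2(1)] 1(2) 2(2,3) add_mono by blast
qed

lemma runs_While_count:
  assumes init: "I 0 g M"
    and step: "\<And>i g M. i < k \<Longrightarrow> I i g M \<Longrightarrow> g r \<noteq> 0 \<and> runs w P g M b (I (Suc i))"
    and stop: "\<And>g M. I k g M \<Longrightarrow> g r = 0"
  shows "runs w (WhileNZ r P) g M (k * (b + 1) + 1) (I k)"
proof -
  have "runs w (WhileNZ r P) g M (j * (b + 1) + 1) (I k)" if "I i g M" "i + j = k" for i j g M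
    using that
  proof (induction j arbitrary: i g M)
    case 0
    then show ?case
      unfolding runs_def using exec_While_stop[of "\<lparr>reg = g, mem = M\<rparr>" r w P] stop by auto
  next
    case (Suc j)
    obtain t g1 M1 where 1: "g r \<noteq> 0" "exec w P \<lparr>reg = g, mem = M\<rparr> t \<lparr>reg = g1, mem = M1\<rparr>"
      "t \<le> b" "I (Suc i) g1 M1"
      using step[of i g M] Suc.prems unfolding runs_def by auto
    have "runs w (WhileNZ r P) g1 M1 (j * (b + 1) + 1) (I k)"
      using Suc.IH[OF 1(4)] Suc.prems by simp
    then obtain u g2 M2 where 2: "exec w (WhileNZ r P) \<lparr>reg = g1, mem = M1\<rparr> u \<lparr>reg = g2, mem = M2\<rparr>"
      "u \<le> j * (b + 1) + 1" "I k g2 M2"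
      unfolding runs_def by blast
    have "exec w (WhileNZ r P) \<lparr>reg = g, mem = M\<rparr> (1 + t + u) \<lparr>reg = g2, mem = M2\<rparr>"
      using exec_While_step[OF _ 1(2) 2(1)] 1(1) by simp
    moreover have "1 + t + u \<le> Suc j * (b + 1) + 1"
      using 1(3) 2(2) by simp
    ultimately show ?case unfolding runs_def using 2(3) by blast
  qed
  from this[OF init] show ?thesis by simp
qed

definition block :: "com list \<Rightarrow> com" where
  "block cs = foldr Seq cs Skip"

text \<open>
  Verification condition of straight-line code in which constants, sums and products do not
  overflow; under it the word length disappears from the resulting state.
\<close>

fun vc :: "nat \<Rightarrow> com list \<Rightarrow> (nat \<Rightarrow> nat) \<Rightarrow> (nat \<Rightarrow> nat) \<Rightarrow>
    ((nat \<Rightarrow> nat) \<Rightarrow> (nat \<Rightarrow> nat) \<Rightarrow> bool) \<Rightarrow> bool" where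
  "vc w [] g M Q \<longleftrightarrow> Q g M"
| "vc w (Const r v # cs) g M Q \<longleftrightarrow> v < 2 ^ w \<and> vc w cs (g(r := v)) M Q"
| "vc w (Op Add r a b # cs) g M Q \<longleftrightarrow> g a + g b < 2 ^ w \<and> vc w cs (g(r := g a + g b)) M Q"
| "vc w (Op Mul r a b # cs) g M Q \<longleftrightarrow> g a * g b < 2 ^ w \<and> vc w cs (g(r := g a * g b)) M Q"
| "vc w (Op Sub r a b # cs) g M Q \<longleftrightarrow> vc w cs (g(r := g a - g b)) M Q"
| "vc w (Op Quot r a b # cs) g M Q \<longleftrightarrow> vc w cs (g(r := g a div g b)) M Q"
| "vc w (Op Rem r a b # cs) g M Q \<longleftrightarrow> vc w cs (g(r := g a mod g b)) M Q"
| "vc w (Op Less r a b # cs) g M Q \<longleftrightarrow> vc w cs (g(r := of_bool (g a < g b))) M Q"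
| "vc w (Op Equal r a b # cs) g M Q \<longleftrightarrow> vc w cs (g(r := of_bool (g a = g b))) M Q"
| "vc w (Load r a # cs) g M Q \<longleftrightarrow> vc w cs (g(r := M (g a))) M Q"
| "vc w (Store a r # cs) g M Q \<longleftrightarrow> vc w cs g (M(g a := g r)) Q"
| "vc w (_ # cs) g M Q \<longleftrightarrow> False"

lemma runs_block_Cons:
  assumes "exec w c \<lparr>reg = g, mem = M\<rparr> 1 \<lparr>reg = g', mem = M'\<rparr>" "runs w (block cs) g' M' b Q"
  shows "runs w (block (c # cs)) g M (Suc b) Q"
proof -
  have "runs w c g M 1 (\<lambda>x y. x = g' \<and> y = M')"
    unfolding runs_def using assms(1) by blast
  then have "runs w (Seq c (block cs)) g M (1 + b) Q"
    by (rule runs_Seq) (use assms(2) in auto)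
  then show ?thesis by (simp add: block_def)
qed

lemma exec_Op_ram:
  "binop_val w f (g a) (g b) = v \<Longrightarrow>
   exec w (Op f r a b) \<lparr>reg = g, mem = M\<rparr> 1 \<lparr>reg = g(r := v), mem = M\<rparr>"
  using exec_Op[of w f r a b "\<lparr>reg = g, mem = M\<rparr>"] by simp

lemma exec_Const_ram:
  "v < 2 ^ w \<Longrightarrow> exec w (Const r v) \<lparr>reg = g, mem = M\<rparr> 1 \<lparr>reg = g(r := v), mem = M\<rparr>"
  using exec_Const[of w r v "\<lparr>reg = g, mem = M\<rparr>"] by simp

lemma exec_Load_ram:
  "exec w (Load r a) \<lparr>reg = g, mem = M\<rparr> 1 \<lparr>reg = g(r := M (g a)), mem = M\<rparr>"
  using exec_Load[of w r a "\<lparr>reg = g, mem = M\<rparr>"] by simp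

lemma exec_Store_ram:
  "exec w (Store a r) \<lparr>reg = g, mem = M\<rparr> 1 \<lparr>reg = g, mem = M(g a := g r)\<rparr>"
  using exec_Store[of w a r "\<lparr>reg = g, mem = M\<rparr>"] by simp

lemma runs_block_length:
  "vc w cs g M Q \<Longrightarrow> runs w (block cs) g M (length cs + 1) Q"
proof (induction w cs g M Q rule: vc.induct)
  case (1 w g M Q)
  then show ?case
    unfolding runs_def block_def using exec_Skip[of w "\<lparr>reg = g, mem = M\<rparr>"] by auto
qed (auto intro!: runs_block_Cons exec_Op_ram exec_Const_ram exec_Load_ram exec_Store_ram)

lemma runs_block:
  assumes "vc w cs g M Q" "length cs < b"
  shows "runs w (block cs) g M b Q"
  by (rule runs_weaken[OF runs_block_length[OF assms(1)]]) (use assms(2) in auto)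


section \<open>The table\<close>

locale alignment_table =
  fixes m n :: nat and inp :: "nat \<Rightarrow> nat"
  assumes m_pos: "1 \<le> m" and n_pos: "1 \<le> n"
    and weight_le: "\<And>i. i \<le> n \<Longrightarrow> inp (2 + i) \<le> n"
begin

definition B :: nat where "B = n + 1"
definition N :: nat where "N = B ^ m"
definition ones :: nat where "ones = (\<Sum>k<m. B ^ k)"
definition inft :: nat where "inft = B * N"

definition dig :: "nat \<Rightarrow> nat \<Rightarrow> nat" where
  "dig p k = p div B ^ k mod B"

primrec best :: "(nat \<Rightarrow> nat) \<Rightarrow> nat \<Rightarrow> nat \<Rightarrow> nat" where
  "best f p 0 = inft"
| "best f p (Suc k) = min (best f p k) (f (p - B ^ k) + of_bool (dig p k = 0) * inft)"

definition matches :: "nat \<Rightarrow> nat \<Rightarrow> bool" where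
  "matches p k \<longleftrightarrow> (\<forall>j<k. dig p j \<noteq> 0 \<and> inp (n + 2 + j * n + dig p j) = inp (n + 2 + dig p 0))"

definition cell :: "(nat \<Rightarrow> nat) \<Rightarrow> nat \<Rightarrow> nat" where
  "cell f p = min (best f p m)
     ((f (p - (N + ones)) div N + inp (2 + dig p 0)) * N + p mod N + of_bool (\<not> matches p m) * inft)"

primrec tab :: "nat \<Rightarrow> nat \<Rightarrow> nat" where
  "tab 0 = (\<lambda>_. 0)"
| "tab (Suc i) = (tab i)(N + i := cell (tab i) (N + i))"

lemma B_gt_1: "1 < B" and B_pos: "0 < B" and N_pos: "0 < N"
  using n_pos by (auto simp: B_def N_def)

lemma pow_le_N: "k < m \<Longrightarrow> B ^ k \<le> N"
  unfolding N_def using B_pos by (simp add: power_increasing)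

lemma pow_lt_N: "k < m \<Longrightarrow> B ^ k < N"
  unfolding N_def using B_gt_1 by simp

lemma sub_pow_less: "k < m \<Longrightarrow> N \<le> p \<Longrightarrow> p - B ^ k < p"
  using pow_le_N[of k] B_pos by (metis diff_less less_le_trans N_pos zero_less_power)

lemma dig_lt: "dig p k < B"
  unfolding dig_def using B_pos by simp

lemma div_pow_split: "p div B ^ k = p div B ^ Suc k * B + dig p k"
  unfolding dig_def by (metis div_mult_mod_eq div_mult2_eq mult.commute power_Suc)

lemma dig_mod_pow:
  assumes "j < k"
  shows "dig (x mod B ^ k) j = dig x j"
proof -
  have "k = j + Suc (k - Suc j)" using assms by simp
  then have e: "B ^ k = B ^ j * (B * B ^ (k - Suc j))"
    by (metis power_Suc power_add)
  have "x mod B ^ k div B ^ j = (x div B ^ j) mod (B * B ^ (k - Suc j))"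
    unfolding e mod_mult2_eq using B_pos by simp
  then show ?thesis unfolding dig_def by (simp add: mod_mod_cancel)
qed

lemma dig_sub_pow:
  assumes "dig p k \<noteq> 0"
  shows "dig (p - B ^ k) j = (if j = k then dig p k - 1 else dig p j)"
    and "k < m \<Longrightarrow> (p - B ^ k) div N = p div N"
proof -
  define hi lo i where "hi = p div B ^ Suc k" and "lo = p mod B ^ k" and "i = dig p k"
  have lo: "lo < B ^ k" unfolding lo_def using B_pos by simp
  have i: "0 < i" "i < B" using assms dig_lt unfolding i_def by auto
  have p: "p = (hi * B + i) * B ^ k + lo"
    using div_pow_split[of p k] unfolding hi_def lo_def i_def by (metis div_mult_mod_eq)
  have "(hi * B + i) * B ^ k = (hi * B + (i - 1)) * B ^ k + B ^ k"
    using i by (cases i) (auto simp: algebra_simps)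
  then have q: "p - B ^ k = (hi * B + (i - 1)) * B ^ k + lo" using p by simp
  have qk: "(p - B ^ k) div B ^ k = hi * B + (i - 1)"
    unfolding q using lo B_pos by (simp add: div_mult_self3)
  have qlo: "(p - B ^ k) mod B ^ k = p mod B ^ k"
    unfolding q using lo by (simp add: lo_def)
  have qhi: "(p - B ^ k) div B ^ Suc k = p div B ^ Suc k"
  proof -
    have "(p - B ^ k) div B ^ Suc k = (p - B ^ k) div B ^ k div B"
      by (metis div_mult2_eq mult.commute power_Suc)
    also have "\<dots> = hi" unfolding qk using i B_pos by (subst div_mult_self3) auto
    finally show ?thesis unfolding hi_def .
  qed
  have high: "(p - B ^ k) div B ^ j = p div B ^ j" if "k < j" for j
  proof -
    have "B ^ j = B ^ Suc k * B ^ (j - Suc k)"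
      using that by (metis Suc_leI le_add_diff_inverse power_add)
    then show ?thesis using qhi by (metis div_mult2_eq)
  qed
  then show "k < m \<Longrightarrow> (p - B ^ k) div N = p div N" unfolding N_def .
  have low: "dig (p - B ^ k) j = dig p j" if "j < k" for j
  proof -
    show ?thesis using qlo dig_mod_pow[OF that] by metis
  qed
  have "dig (p - B ^ k) k = i - 1"
    unfolding dig_def qk using i by (subst mod_mult_self3) simp
  then show "dig (p - B ^ k) j = (if j = k then dig p k - 1 else dig p j)"
    using low high unfolding i_def dig_def by (metis linorder_neqE_nat)
qed

lemma dig_sub_ones:
  assumes "\<And>k. k < m \<Longrightarrow> dig p k \<noteq> 0" "j \<le> m"
  shows "dig (p - (\<Sum>k<j. B ^ k)) i = (if i < j then dig p i - 1 else dig p i)"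
    and "(p - (\<Sum>k<j. B ^ k)) div N = p div N"
proof -
  have "(\<forall>i. dig (p - (\<Sum>k<j. B ^ k)) i = (if i < j then dig p i - 1 else dig p i)) \<and>
        (p - (\<Sum>k<j. B ^ k)) div N = p div N"
    using assms(2)
  proof (induction j)
    case (Suc j)
    define q where "q = p - (\<Sum>k<j. B ^ k)"
    have q: "\<And>i. dig q i = (if i < j then dig p i - 1 else dig p i)" "q div N = p div N"
      using Suc unfolding q_def by auto
    have nz: "dig q j \<noteq> 0" using q assms(1)[of j] Suc.prems by simp
    have "p - (\<Sum>k<Suc j. B ^ k) = q - B ^ j" unfolding q_def by simp
    then show ?case using dig_sub_pow(1)[OF nz] dig_sub_pow(2)[OF nz] q Suc.prems
      by (auto simp: less_Suc_eq)
  qed auto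
  then show "dig (p - (\<Sum>k<j. B ^ k)) i = (if i < j then dig p i - 1 else dig p i)"
    and "(p - (\<Sum>k<j. B ^ k)) div N = p div N" by auto
qed

lemma dig_mod_N: "k < m \<Longrightarrow> dig (p mod N) k = dig p k"
  unfolding N_def by (rule dig_mod_pow)

lemma dig_layer: "k < m \<Longrightarrow> dig (l * N + x) k = dig x k"
  by (metis dig_mod_N mod_mult_self3)

lemma ones_le:
  assumes "\<And>k. k < m \<Longrightarrow> dig p k \<noteq> 0"
  shows "ones \<le> p"
proof -
  have "(\<Sum>k<j. B ^ k) \<le> p" if "j \<le> m" for j
    using that
  proof (induction j)
    case (Suc j)
    define q where "q = p - (\<Sum>k<j. B ^ k)"
    have "dig q j \<noteq> 0"
      using dig_sub_ones(1)[OF assms, of j j] assms[of j] Suc.prems unfolding q_def by auto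
    then have "B ^ j \<le> q" unfolding dig_def
      by (metis div_less mod_0 not_le)
    then show ?case using Suc unfolding q_def by simp
  qed simp
  then show ?thesis unfolding ones_def by simp
qed

lemma diag_pred:
  assumes "\<And>k. k < m \<Longrightarrow> dig p k \<noteq> 0" "p div N = Suc l"
  shows "\<And>k. k < m \<Longrightarrow> dig (p - (N + ones)) k = dig p k - 1"
    and "(p - (N + ones)) div N = l"
    and "p - (N + ones) = l * N + (p mod N - ones)"
proof -
  define q where "q = p - N"
  have "N \<le> p" using assms(2) by (cases "p < N") auto
  then have p: "p = q + N" unfolding q_def by simp
  have qd: "q div N = l" using assms(2) N_pos unfolding p by simp
  have dq: "dig q k = dig p k" if "k < m" for k
    using dig_mod_N[OF that, of p] dig_mod_N[OF that, of q] unfolding p by simp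
  have e: "p - (N + ones) = q - ones" unfolding q_def by simp
  have nz: "\<And>k. k < m \<Longrightarrow> dig q k \<noteq> 0" using dq assms(1) by simp
  show "dig (p - (N + ones)) k = dig p k - 1" if "k < m" for k
    unfolding e unfolding ones_def using dig_sub_ones(1)[OF nz, of m k] that dq by simp
  show "(p - (N + ones)) div N = l"
    unfolding e unfolding ones_def using dig_sub_ones(2)[OF nz, of m] qd by simp
  have "ones \<le> p mod N" using ones_le[of "p mod N"] dig_mod_N assms(1) by auto
  moreover have "p mod N = q mod N" unfolding p by simp
  ultimately show "p - (N + ones) = l * N + (p mod N - ones)"
    unfolding e using qd by (metis Nat.add_diff_assoc div_mult_mod_eq)
qed

lemma best_le_inft: "best f p k \<le> inft"
  by (induction k) auto

lemma best_le:
  "k < j \<Longrightarrow> dig p k \<noteq> 0 \<Longrightarrow> best f p j \<le> f (p - B ^ k)"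
  by (induction j) (auto simp: less_Suc_eq min_def)

lemma best_cases:
  "best f p j = inft \<or> (\<exists>k<j. dig p k \<noteq> 0 \<and> best f p j = f (p - B ^ k))"
proof (induction j)
  case (Suc j)
  then show ?case using best_le_inft[of f p j]
    by (cases "dig p j = 0") (auto simp: min_def less_Suc_eq)
qed simp

lemma best_cong:
  assumes "\<And>r. r < p \<Longrightarrow> f r = g r" "N \<le> p" "k \<le> m"
  shows "best f p k = best g p k"
  using assms(3)
proof (induction k)
  case (Suc k)
  then show ?case using assms(1)[OF sub_pow_less] assms(2) by simp
qed simp

lemma cell_cong:
  assumes "\<And>r. r < p \<Longrightarrow> f r = g r" "N \<le> p"
  shows "cell f p = cell g p"
proof -
  have "f (p - (N + ones)) = g (p - (N + ones))"
    using assms N_pos by (intro assms(1)) simp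
  then show ?thesis
    unfolding cell_def using best_cong[OF assms order_refl] by simp
qed

lemma tab_le_inft: "tab i q \<le> inft"
  by (induction i) (auto simp: cell_def best_le_inft min.coboundedI1)

lemma tab_low: "q < N \<Longrightarrow> tab i q = 0"
  by (induction i) auto

lemma tab_add: "q < N + i \<Longrightarrow> tab (i + j) q = tab i q"
  by (induction j) auto

lemma tab_cell:
  assumes "N \<le> q" "q < N + i"
  shows "tab i q = cell (tab i) q"
proof -
  define a where "a = q - N"
  have q: "q = N + a" "a < i" using assms unfolding a_def by auto
  have stable: "tab i r = tab (Suc a) r" if "r \<le> q" for r
    using tab_add[of r "Suc a" "i - Suc a"] that q by simp
  have "cell (tab i) q = cell (tab a) q"
    using assms(1) by (intro cell_cong) (use stable q in auto)
  then show ?thesis using stable[of q] q by simp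
qed

definition chr :: "nat \<Rightarrow> nat \<Rightarrow> nat" where
  "chr k i = inp (n + 3 + k * n + i)"

text \<open>Column \<open>j < l\<close> of an alignment of the prefixes of lengths \<open>D k\<close> consists of the positions \<open>e k j\<close>.\<close>

definition ali :: "nat \<Rightarrow> (nat \<Rightarrow> nat) \<Rightarrow> (nat \<Rightarrow> nat \<Rightarrow> nat) \<Rightarrow> bool" where
  "ali l D e \<longleftrightarrow> (\<forall>k<m. (\<forall>j. Suc j < l \<longrightarrow> e k j < e k (Suc j)) \<and>
     (\<forall>j<l. e k j < D k \<and> chr k (e k j) = chr 0 (e 0 j)))"

lemma aliI:
  assumes "\<And>k j. k < m \<Longrightarrow> Suc j < l \<Longrightarrow> e k j < e k (Suc j)"
    and "\<And>k j. k < m \<Longrightarrow> j < l \<Longrightarrow> e k j < D k"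
    and "\<And>k j. k < m \<Longrightarrow> j < l \<Longrightarrow> chr k (e k j) = chr 0 (e 0 j)"
  shows "ali l D e"
  using assms unfolding ali_def by blast

lemma aliD:
  assumes "ali l D e" "k < m"
  shows "Suc j < l \<Longrightarrow> e k j < e k (Suc j)"
    and "j < l \<Longrightarrow> e k j < D k"
    and "j < l \<Longrightarrow> chr k (e k j) = chr 0 (e 0 j)"
  using assms unfolding ali_def by blast+

lemma ali_weaken:
  assumes "ali l D e" "l' \<le> l" "\<And>k j. k < m \<Longrightarrow> j < l' \<Longrightarrow> e k j < D' k"
  shows "ali l' D' e"
proof (rule aliI)
  fix k j
  assume k: "k < m"
  show "e k j < e k (Suc j)" if "Suc j < l'"
    using aliD(1)[OF assms(1) k] that assms(2) by (meson less_le_trans)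
  show "chr k (e k j) = chr 0 (e 0 j)" if "j < l'"
    using aliD(3)[OF assms(1) k] that assms(2) by (meson less_le_trans)
qed (fact assms(3))

lemma ali_strict_mono:
  assumes "ali l D e" "k < m" "j < j'" "j' < l"
  shows "e k j < e k j'"
proof -
  have "e k j < e k (j + Suc a)" if "j + Suc a < l" for a
    using that by (induction a) (auto intro: less_trans aliD(1)[OF assms(1,2)])
  from this[of "j' - Suc j"] show ?thesis using assms by simp
qed

definition weight :: "nat \<Rightarrow> (nat \<Rightarrow> nat \<Rightarrow> nat) \<Rightarrow> nat" where
  "weight l e = (\<Sum>j<l. inp (3 + e 0 j))"

lemma matches_iff:
  "matches p m \<longleftrightarrow> (\<forall>k<m. dig p k \<noteq> 0 \<and> chr k (dig p k - 1) = chr 0 (dig p 0 - 1))"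
proof -
  have e: "chr k (dig p k - 1) = inp (n + 2 + k * n + dig p k)" if "dig p k \<noteq> 0" for k
    using that unfolding chr_def by (intro arg_cong[of _ _ inp]) simp
  have "chr 0 (dig p 0 - 1) = inp (n + 2 + dig p 0)" if "dig p 0 \<noteq> 0"
    using e[OF that] by simp
  moreover have "0 < m" using m_pos by simp
  ultimately show ?thesis unfolding matches_def using e by metis
qed

lemma cell_match:
  assumes "matches p m" "cell f p \<noteq> best f p m"
  shows "cell f p = (f (p - (N + ones)) div N + inp (2 + dig p 0)) * N + p mod N"
  using assms unfolding cell_def by (auto simp: min_def)

lemma tab_lower_bound:
  assumes "p < N + i" "ali (p div N) (dig p) e"
  shows "tab i p div N \<le> weight (p div N) e"
  using assms
proof (induction p rule: less_induct)
  case (less p)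
  show ?case
  proof (cases "p div N")
    case 0
    then have "p < N" using N_pos by (simp add: div_eq_0_iff)
    then show ?thesis using tab_low by simp
  next
    case (Suc l)
    then have "N \<le> p" by (cases "p < N") auto
    then have eq: "tab i p = cell (tab i) p" using tab_cell less.prems by simp
    have al: "ali (Suc l) (dig p) e" using less.prems Suc by simp
    then have last: "e k l < dig p k" "chr k (e k l) = chr 0 (e 0 l)" if "k < m" for k
      using aliD(2,3)[OF _ that, of "Suc l" "dig p" e l] by auto
    show ?thesis
    proof (cases "\<forall>k<m. e k l = dig p k - 1")
      case True
      have nz: "dig p k \<noteq> 0" if "k < m" for k using last(1)[OF that] by simp
      have "0 < m" using m_pos by simp
      then have mt: "matches p m" using matches_iff last(2) True nz by metis
      define q where "q = p - (N + ones)"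
      note dp = diag_pred[OF nz Suc, folded q_def]
      have "q < p" unfolding q_def using N_pos \<open>N \<le> p\<close> by simp
      have "ali l (dig q) e"
      proof (rule ali_weaken[OF al])
        show "e k j < dig q k" if "k < m" "j < l" for k j
          using ali_strict_mono[OF al that(1), of j l] that dp(1) True by simp
      qed simp
      then have "tab i q div N \<le> weight l e"
        using less.IH[OF \<open>q < p\<close>] \<open>q < p\<close> less.prems dp by simp
      moreover have "inp (2 + dig p 0) = inp (3 + e 0 l)"
        using True nz[of 0] m_pos by (intro arg_cong[of _ _ inp]) auto
      moreover have "tab i p \<le> (tab i q div N + inp (2 + dig p 0)) * N + p mod N"
        unfolding eq cell_def q_def using mt by simp
      then have "tab i p div N \<le> ((tab i q div N + inp (2 + dig p 0)) * N + p mod N) div N"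
        by (rule div_le_mono)
      then have "tab i p div N \<le> tab i q div N + inp (2 + dig p 0)"
        using N_pos by (simp add: div_mult_self3)
      ultimately show ?thesis using Suc unfolding weight_def by simp
    next
      case False
      then obtain k where k: "k < m" "e k l \<noteq> dig p k - 1" by blast
      with last(1) have lt: "e k l < dig p k - 1" by (metis Suc_diff_1 less_antisym not_less0 neq0_conv)
      then have nz: "dig p k \<noteq> 0" by simp
      define q where "q = p - B ^ k"
      have "q < p" unfolding q_def using sub_pow_less k \<open>N \<le> p\<close> by simp
      have kl: "e k j < dig p k - 1" if "j < Suc l" for j
        using ali_strict_mono[OF al k(1), of j l] lt that by (cases "j = l") auto
      have "ali (Suc l) (dig q) e"
      proof (rule ali_weaken[OF al])
        show "e k' j < dig q k'" if "k' < m" "j < Suc l" for k' j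
          using dig_sub_pow(1)[OF nz] aliD(2)[OF al that] kl[OF that(2)] unfolding q_def by simp
      qed simp
      then have "tab i q div N \<le> weight (Suc l) e"
        using less.IH[OF \<open>q < p\<close>] \<open>q < p\<close> less.prems dig_sub_pow(2)[OF nz] k Suc
        unfolding q_def by simp
      moreover have "tab i p \<le> tab i q"
        unfolding eq cell_def q_def using best_le[OF k(1) nz, of "tab i"] by simp
      ultimately show ?thesis unfolding Suc by (meson div_le_mono order_trans)
    qed
  qed
qed

text \<open>Modulo \<open>N\<close>, a finite entry of layer \<open>Suc l\<close> points to the last column of an optimal alignment.\<close>

lemma tab_pointer:
  assumes "p < N + i" "p div N = Suc l" "tab i p < inft"
  defines "r \<equiv> Suc l * N + tab i p mod N"
  shows "matches r m \<and> (\<forall>k<m. dig r k \<le> dig p k) \<and> r \<le> p \<and>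
    tab i p div N = tab i (r - (N + ones)) div N + inp (2 + dig r 0) \<and>
    tab i (r - (N + ones)) < inft"
  using assms(1-3) unfolding r_def
proof (induction p rule: less_induct)
  case (less p)
  then have "N \<le> p" by (cases "p < N") auto
  then have eq: "tab i p = cell (tab i) p" using tab_cell less.prems by simp
  show ?case
  proof (cases "cell (tab i) p = best (tab i) p m")
    case True
    then obtain k where k: "k < m" "dig p k \<noteq> 0" "tab i p = tab i (p - B ^ k)"
      using best_cases[of "tab i" p m] eq less.prems by auto
    have "p - B ^ k < p" using sub_pow_less k \<open>N \<le> p\<close> by simp
    then have "matches (Suc l * N + tab i p mod N) m \<and>
      (\<forall>j<m. dig (Suc l * N + tab i p mod N) j \<le> dig (p - B ^ k) j) \<and>
      Suc l * N + tab i p mod N \<le> p - B ^ k \<and>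
      tab i p div N = tab i (Suc l * N + tab i p mod N - (N + ones)) div N +
        inp (2 + dig (Suc l * N + tab i p mod N) 0) \<and>
      tab i (Suc l * N + tab i p mod N - (N + ones)) < inft"
      using less.IH[of "p - B ^ k"] less.prems dig_sub_pow(2)[OF k(2) k(1)] k(3) by simp
    moreover have "dig (p - B ^ k) j \<le> dig p j" for j
      using dig_sub_pow(1)[OF k(2)] by simp
    ultimately show ?thesis by (meson order_trans diff_le_self)
  next
    case False
    have mt: "matches p m"
    proof (rule ccontr)
      assume "\<not> matches p m"
      then have "inft \<le> cell (tab i) p" using False unfolding cell_def by (auto simp: min_def split: if_splits)
      then show False using eq less.prems by simp
    qed
    define v where "v = tab i (p - (N + ones)) div N + inp (2 + dig p 0)"
    have t: "tab i p = v * N + p mod N"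
      using cell_match[OF mt False] eq unfolding v_def by simp
    have md: "tab i p mod N = p mod N" and dv: "tab i p div N = v"
      unfolding t using N_pos by auto
    have r: "Suc l * N + tab i p mod N = p"
      unfolding md using less.prems(2) by (metis div_mult_mod_eq)
    have "tab i (p - (N + ones)) < inft"
    proof -
      have "v < B" using less.prems(3) dv unfolding inft_def
        by (metis less_mult_imp_div_less)
      then have "tab i (p - (N + ones)) div N < B" unfolding v_def by simp
      then show ?thesis unfolding inft_def using N_pos by (simp add: div_less_iff_less_mult)
    qed
    then show ?thesis unfolding r using mt dv unfolding v_def by simp
  qed
qed

primrec trace :: "(nat \<Rightarrow> nat) \<Rightarrow> nat \<Rightarrow> nat \<Rightarrow> nat \<Rightarrow> nat \<Rightarrow> nat" where
  "trace f 0 x k j = 0"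
| "trace f (Suc l) x k j =
     (let r = f (Suc l * N + x) mod N
      in if j = l then dig r k - 1 else trace f l (r - ones) k j)"

lemma trace_correct:
  assumes "Suc l * N \<le> N + i" "x < N" "tab i (l * N + x) < inft"
  shows "ali l (dig x) (trace (tab i) l x) \<and>
    tab i (l * N + x) div N = weight l (trace (tab i) l x)"
  using assms
proof (induction l arbitrary: x)
  case 0
  then show ?case unfolding ali_def weight_def using tab_low by simp
next
  case (Suc l)
  define p where "p = Suc l * N + x"
  define y where "y = tab i p mod N"
  define r where "r = Suc l * N + y"
  have y: "y < N" unfolding y_def using N_pos by simp
  have p: "p < N + i" "p div N = Suc l"
    using Suc.prems N_pos unfolding p_def by (simp, subst div_mult_self3, auto)
  have pt: "matches r m" "\<And>k. k < m \<Longrightarrow> dig r k \<le> dig p k"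
    "tab i p div N = tab i (r - (N + ones)) div N + inp (2 + dig r 0)"
    "tab i (r - (N + ones)) < inft"
    using tab_pointer[OF p] Suc.prems unfolding r_def y_def p_def by auto
  have nz: "\<And>k. k < m \<Longrightarrow> dig r k \<noteq> 0" using pt(1) matches_iff by blast
  have rN: "r div N = Suc l" "r mod N = y"
    unfolding r_def using y by (subst div_mult_self3, auto) (metis mod_mult_self3 mod_less mult_Suc)
  have dp: "\<And>k. k < m \<Longrightarrow> dig (r - (N + ones)) k = dig r k - 1"
    "r - (N + ones) = l * N + (y - ones)"
    using diag_pred(1,3)[OF nz rN(1)] rN(2) by auto
  have dx: "dig p k = dig x k" "dig r k = dig y k" if "k < m" for k
    unfolding p_def r_def by (rule dig_layer[OF that])+
  have IH: "ali l (dig (y - ones)) (trace (tab i) l (y - ones))"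
    "tab i (l * N + (y - ones)) div N = weight l (trace (tab i) l (y - ones))"
    using Suc.IH[of "y - ones"] Suc.prems(1) y pt(4) unfolding dp(2) by auto
  have tr: "trace (tab i) (Suc l) x k j = (if j = l then dig y k - 1 else trace (tab i) l (y - ones) k j)" for k j
    unfolding y_def p_def by (simp add: Let_def)
  have dy: "dig (y - ones) k = dig y k - 1" if "k < m" for k
    using dp(1)[OF that] dig_layer[OF that, of l "y - ones"] dx(2)[OF that] unfolding dp(2) by simp
  have "0 < m" using m_pos by simp
  have last_chr: "chr k (dig y k - 1) = chr 0 (dig y 0 - 1)" if "k < m" for k
    using pt(1) dx(2)[OF that] dx(2)[OF \<open>0 < m\<close>] that unfolding matches_iff by metis
  have last_lt: "dig y k - 1 < dig x k" if "k < m" for k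
    using pt(2)[OF that] nz[OF that] dx[OF that] by simp
  have prev_lt: "trace (tab i) l (y - ones) k j < dig y k - 1" if "k < m" "j < l" for k j
    using aliD(2)[OF IH(1) that] dy[OF that(1)] by simp
  have "ali (Suc l) (dig x) (trace (tab i) (Suc l) x)"
  proof (rule aliI)
    fix k j
    assume k: "k < m"
    show "trace (tab i) (Suc l) x k j < trace (tab i) (Suc l) x k (Suc j)" if "Suc j < Suc l"
      unfolding tr using that aliD(1)[OF IH(1) k] prev_lt[OF k] by auto
    show "trace (tab i) (Suc l) x k j < dig x k" if "j < Suc l"
      unfolding tr using that prev_lt[OF k, of j] last_lt[OF k] by (cases "j = l") auto
    show "chr k (trace (tab i) (Suc l) x k j) = chr 0 (trace (tab i) (Suc l) x 0 j)" if "j < Suc l"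
    proof (cases "j = l")
      case True
      then show ?thesis unfolding tr using last_chr[OF k] by simp
    next
      case False
      then show ?thesis unfolding tr using aliD(3)[OF IH(1) k, of j] that by simp
    qed
  qed
  moreover have "inp (2 + dig r 0) = inp (3 + (dig y 0 - 1))"
    using nz[of 0] dx(2)[of 0] m_pos by (intro arg_cong[of _ _ inp]) auto
  then have "tab i p div N = weight (Suc l) (trace (tab i) (Suc l) x)"
    using pt(3) IH(2) unfolding weight_def tr dp(2) by simp
  ultimately show ?case unfolding p_def by blast
qed

end


section \<open>The program\<close>

definition setup_code :: "com list" where
  "setup_code = [Const 8 1, Const 14 0, Load 2 14, Load 3 8, Op Add 15 8 8, Load 16 15, Op Sub 0 3 16,
     Op Add 4 3 8, Op Mul 7 2 3, Op Add 7 7 3, Op Add 7 7 15, Op Add 7 7 8, Op Add 10 3 15,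
     Const 5 1, Const 6 0, Op Sub 12 2 14]"

definition power_code :: "com list" where
  "power_code = [Op Add 6 6 5, Op Mul 5 5 4, Op Sub 12 12 8]"

definition start_code :: "com list" where
  "start_code = [Op Mul 9 4 5, Op Mul 11 0 5, Op Sub 16 5 14, Op Add 1 7 5, Op Add 1 1 11]"

definition cell_pre :: "com list" where
  "cell_pre = [Op Sub 17 16 14, Op Sub 18 9 14, Op Sub 19 8 14, Op Sub 20 8 14, Op Sub 21 10 14,
     Op Rem 22 16 4, Op Add 23 22 10, Load 23 23, Op Add 24 22 15, Load 24 24, Op Add 25 7 16,
     Op Sub 12 2 14]"

text \<open>The minimum of \<open>x\<close> and \<open>y\<close> is computed as the truncated difference \<open>x - (x - y)\<close>.\<close>

definition cell_step :: "com list" where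
  "cell_step = [Op Rem 26 17 4, Op Quot 17 17 4, Op Equal 27 26 14,
     Op Sub 28 25 19, Load 28 28, Op Mul 29 27 9, Op Add 28 28 29, Op Sub 29 18 28, Op Sub 18 18 29,
     Op Add 29 21 26, Load 29 29, Op Equal 29 29 23, Op Mul 20 20 29, Op Sub 29 8 27, Op Mul 20 20 29,
     Op Mul 19 19 4, Op Add 21 21 3, Op Sub 12 12 8]"

definition cell_post :: "com list" where
  "cell_post = [Op Add 26 5 6, Op Sub 26 16 26, Op Add 26 26 7, Load 26 26, Op Quot 26 26 5,
     Op Add 26 26 24, Op Mul 26 26 5, Op Rem 27 16 5, Op Add 26 26 27, Op Sub 27 8 20, Op Mul 27 27 9,
     Op Add 26 26 27, Op Sub 27 18 26, Op Sub 18 18 27, Store 25 18, Op Add 16 16 8, Op Sub 11 11 8]"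

definition trace_start :: "com list" where
  "trace_start = [Op Sub 11 0 14, Op Sub 16 5 8]"

definition trace_pre :: "com list" where
  "trace_pre = [Op Mul 17 11 5, Op Add 17 17 16, Op Add 17 17 7, Load 17 17, Op Rem 17 17 5,
     Op Sub 16 17 6, Op Sub 11 11 8, Op Rem 18 17 4, Op Sub 18 18 8, Op Add 18 18 10, Op Add 18 18 8,
     Load 18 18, Op Add 19 1 11, Store 19 18, Op Sub 12 2 14]"

definition trace_step :: "com list" where
  "trace_step = [Op Rem 18 17 4, Op Quot 17 17 4, Op Sub 18 18 8, Op Add 19 19 0, Store 19 18,
     Op Sub 12 12 8]"

definition cell_prog :: com where
  "cell_prog = Seq (block cell_pre) (Seq (WhileNZ 12 (block cell_step)) (block cell_post))"

definition trace_prog :: com where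
  "trace_prog = Seq (block trace_pre) (WhileNZ 12 (block trace_step))"

definition alignment_prog :: com where
  "alignment_prog =
     Seq (block setup_code) (Seq (WhileNZ 12 (block power_code)) (Seq (block start_code)
       (Seq (WhileNZ 11 cell_prog) (Seq (block trace_start) (WhileNZ 11 trace_prog)))))"

locale alignment_run = alignment_table +
  fixes L w :: nat
  assumes header: "inp 0 = m" "inp 1 = n" "L = n - inp 2"
    and addr_bound: "3 + n + m * n + N + L * N + (m + 2) * n < 2 ^ w"
    and value_bound: "3 * inft < 2 ^ w"
begin

definition T :: nat where "T = 3 + n + m * n"

text \<open>Registers 5 and 6 are built up by the first loop, and registers 1 and 9 depend on its result.\<close>

definition base_regs :: "(nat \<Rightarrow> nat) \<Rightarrow> bool" where
  "base_regs g \<longleftrightarrow> g 0 = L \<and> g 2 = m \<and> g 3 = n \<and> g 4 = B \<and> g 7 = T \<and> g 8 = 1 \<and>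
     g 10 = n + 2 \<and> g 14 = 0 \<and> g 15 = 2"

definition const_regs :: "(nat \<Rightarrow> nat) \<Rightarrow> bool" where
  "const_regs g \<longleftrightarrow> base_regs g \<and> g 5 = N \<and> g 6 = ones \<and> g 9 = inft \<and> g 1 = T + N + L * N"

definition layout :: "(nat \<Rightarrow> nat) \<Rightarrow> nat \<Rightarrow> nat" where
  "layout f a = (if a < T then inp a else f (a - T))"

lemma L_le: "L \<le> n"
  using header by simp

lemma table_bound: "T + N + L * N + m * n + n + n < 2 ^ w"
  using addr_bound unfolding T_def by (auto simp: algebra_simps)

lemma small_bounds: "n + 3 < 2 ^ w" "m * n + n + 3 < 2 ^ w" "N + N < 2 ^ w"
proof -
  have "2 * N \<le> inft" unfolding inft_def using B_gt_1 by simp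
  then show "N + N < 2 ^ w" using value_bound by linarith
qed (use addr_bound in auto)

lemma pow_sum_le: "(\<Sum>k<j. B ^ k) \<le> B ^ j"
proof (induction j)
  case (Suc j)
  have "B ^ j + B ^ j \<le> B * B ^ j" using B_gt_1 by (metis mult_2 mult_le_mono1 Suc_leI numeral_2_eq_2 One_nat_def)
  with Suc show ?case by simp
qed simp

lemma power_loop:
  assumes "base_regs g" "g 5 = 1" "g 6 = 0" "g 12 = m" "Q M"
  shows "runs w (WhileNZ 12 (block power_code)) g M (m * 5 + 1)
    (\<lambda>g M. base_regs g \<and> g 5 = N \<and> g 6 = ones \<and> Q M)"
proof -
  define I where "I j g M \<longleftrightarrow> base_regs g \<and> g 5 = B ^ j \<and> g 6 = (\<Sum>k<j. B ^ k) \<and> g 12 = m - j \<and> Q M"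
    for j g M
  have "runs w (WhileNZ 12 (block power_code)) g M (m * (4 + 1) + 1) (I m)"
  proof (rule runs_While_count)
    show "I 0 g M" using assms unfolding I_def by simp
    show "g 12 = 0" if "I m g M" for g M using that unfolding I_def by simp
    fix j g M assume j: "j < m" and I: "I j g M"
    have "B ^ Suc j \<le> N" unfolding N_def using j B_pos by (intro power_increasing) auto
    then have "B ^ j * B < 2 ^ w" using small_bounds(3) by (simp add: mult.commute)
    moreover have "(\<Sum>k<j. B ^ k) + B ^ j < 2 ^ w"
      using pow_sum_le[of j] pow_lt_N[OF j] small_bounds(3) by linarith
    ultimately have "vc w power_code g M (I (Suc j))"
      using I unfolding I_def base_regs_def power_code_def by (simp add: mult.commute)
    then have "runs w (block power_code) g M 4 (I (Suc j))"
      by (rule runs_block) (simp add: power_code_def)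
    then show "g 12 \<noteq> 0 \<and> runs w (block power_code) g M 4 (I (Suc j))"
      using I j unfolding I_def by simp
  qed
  then show ?thesis by (rule runs_weaken) (auto simp: I_def N_def ones_def)
qed

lemma cell_loop:
  assumes g: "const_regs g" "g 16 = p" "g 17 = p" "g 18 = inft" "g 19 = 1" "g 20 = 1" "g 21 = n + 2"
      "g 23 = inp (n + 2 + dig p 0)" "g 24 = v" "g 25 = T + p" "g 11 = c" "g 12 = m"
    and p: "N \<le> p" and f: "\<And>q. f q \<le> inft"
  shows "runs w (WhileNZ 12 (block cell_step)) g (layout f) (m * 20 + 1)
    (\<lambda>g M. M = layout f \<and> const_regs g \<and> g 16 = p \<and> g 18 = best f p m \<and>
       g 20 = of_bool (matches p m) \<and> g 24 = v \<and> g 25 = T + p \<and> g 11 = c)"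
proof -
  define I where "I j g M \<longleftrightarrow> M = layout f \<and> const_regs g \<and> g 16 = p \<and> g 17 = p div B ^ j \<and>
      g 18 = best f p j \<and> g 19 = B ^ j \<and> g 20 = of_bool (matches p j) \<and> g 21 = n + 2 + j * n \<and>
      g 23 = inp (n + 2 + dig p 0) \<and> g 24 = v \<and> g 25 = T + p \<and> g 11 = c \<and> g 12 = m - j" for j g M
  have "runs w (WhileNZ 12 (block cell_step)) g (layout f) (m * (19 + 1) + 1) (I m)"
  proof (rule runs_While_count)
    show "I 0 g (layout f)" using g unfolding I_def by (simp add: matches_def)
    show "g 12 = 0" if "I m g M" for g M using that unfolding I_def by simp
    fix j g M assume j: "j < m" and I: "I j g M"
    have "B ^ Suc j \<le> N" unfolding N_def using j B_pos by (intro power_increasing) auto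
    then have b1: "B ^ j * B < 2 ^ w" using small_bounds(3) by (simp add: mult.commute)
    have jn: "Suc j * n \<le> m * n" using j by (intro mult_le_mono1) simp
    have dn: "dig p j \<le> n" using dig_lt[of p j] unfolding B_def by simp
    have b2: "n + 2 + j * n + n < T" using jn unfolding T_def by simp
    have b3: "n + 2 + j * n + dig p j < T" using b2 dn by simp
    have tw: "T < 2 ^ w" using table_bound by simp
    have bj: "B ^ j \<le> p" using pow_le_N[OF j] p by simp
    have "T + p - B ^ j = T + (p - B ^ j)" using bj by simp
    then have ld: "layout f (T + p - B ^ j) = f (p - B ^ j)"
      unfolding layout_def by simp
    have lc: "layout f (n + 2 + j * n + dig p j) = inp (n + 2 + j * n + dig p j)"
      using b3 unfolding layout_def by simp
    have b4: "f (p - B ^ j) + inft < 2 ^ w" using f[of "p - B ^ j"] value_bound by linarith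
    have mt: "matches p (Suc j) \<longleftrightarrow> matches p j \<and> dig p j \<noteq> 0 \<and>
        inp (n + 2 + j * n + dig p j) = inp (n + 2 + dig p 0)"
      unfolding matches_def by (auto simp: less_Suc_eq)
    have pd: "p div B ^ j mod B = dig p j" "p div B ^ j div B = p div (B * B ^ j)"
      unfolding dig_def by (auto simp: div_mult2_eq[symmetric] mult.commute)
    have mn: "x - (x - y) = min x y" for x y :: nat by simp
    have "vc w cell_step g M (I (Suc j))"
      using I b1 b2 b3 tw b4
      unfolding I_def const_regs_def base_regs_def cell_step_def mt
      by (simp add: pd ld lc[simplified] mn)
    then have "runs w (block cell_step) g M 19 (I (Suc j))"
      by (rule runs_block) (simp add: cell_step_def)
    then show "g 12 \<noteq> 0 \<and> runs w (block cell_step) g M 19 (I (Suc j))"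
      using I j unfolding I_def by simp
  qed
  then show ?thesis by (rule runs_weaken) (auto simp: I_def)
qed

lemma layout_update: "(layout f)(T + p := c) = layout (f(p := c))"
  unfolding layout_def by (auto simp: fun_eq_iff)

lemma cell_body:
  assumes g: "const_regs g" "g 16 = N + i" "g 11 = L * N - i" and i: "i < L * N"
  shows "runs w cell_prog g (layout (tab i)) (m * 20 + 40)
    (\<lambda>g M. const_regs g \<and> g 16 = N + Suc i \<and> g 11 = L * N - Suc i \<and> M = layout (tab (Suc i)))"
proof -
  define p where "p = N + i"
  define f where "f = tab i"
  define v where "v = inp (2 + dig p 0)"
  define c where "c = L * N - i"
  have f: "f q \<le> inft" for q unfolding f_def by (rule tab_le_inft)
  have dn: "dig p 0 \<le> n" using dig_lt[of p 0] unfolding B_def by simp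
  have d0: "p mod B = dig p 0" unfolding dig_def by simp
  have mn: "n \<le> m * n" using m_pos by simp
  have p: "N \<le> p" "p < N + L * N" unfolding p_def using i by auto
  have tp: "T + p < 2 ^ w" "p + 1 < 2 ^ w" using table_bound p T_def by linarith+
  have a1: "dig p 0 + (n + 2) < T" "dig p 0 + 2 < T" using dn mn unfolding T_def by linarith+
  then have a2: "dig p 0 + (n + 2) < 2 ^ w" "dig p 0 + 2 < 2 ^ w" using tp by auto
  have l1: "layout f (dig p 0 + (n + 2)) = inp (n + 2 + dig p 0)" "layout f (dig p 0 + 2) = v"
    unfolding layout_def v_def using a1 by (auto simp: add.commute)
  define Q1 where "Q1 g M \<longleftrightarrow> M = layout f \<and> const_regs g \<and> g 16 = p \<and> g 17 = p \<and> g 18 = inft \<and>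
    g 19 = 1 \<and> g 20 = 1 \<and> g 21 = n + 2 \<and> g 23 = inp (n + 2 + dig p 0) \<and> g 24 = v \<and> g 25 = T + p \<and>
    g 11 = c \<and> g 12 = m" for g M
  define Q2 where "Q2 g M \<longleftrightarrow> M = layout f \<and> const_regs g \<and> g 16 = p \<and> g 18 = best f p m \<and>
    g 20 = of_bool (matches p m) \<and> g 24 = v \<and> g 25 = T + p \<and> g 11 = c" for g M
  define Q3 where "Q3 g M \<longleftrightarrow> const_regs g \<and> g 16 = Suc p \<and> g 11 = c - 1 \<and>
    M = layout (f(p := cell f p))" for g M
  have "vc w cell_pre g (layout f) Q1"
    using g a2 tp unfolding cell_pre_def const_regs_def base_regs_def Q1_def
    by (simp add: d0 l1[simplified] p_def[symmetric] c_def)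
  then have r1: "runs w (block cell_pre) g (layout f) 13 Q1"
    by (rule runs_block) (simp add: cell_pre_def)
  have r2: "runs w (WhileNZ 12 (block cell_step)) g M (m * 20 + 1) Q2" if "Q1 g M" for g M
    using that cell_loop[of g p v c f, OF _ _ _ _ _ _ _ _ _ _ _ _ p(1) f] unfolding Q1_def Q2_def by auto
  have r3: "runs w (block cell_post) g M 18 Q3" if "Q2 g M" for g M
  proof -
    define q where "q = p - (N + ones)"
    have on: "N + ones < 2 ^ w" using pow_sum_le[of m] small_bounds(3) unfolding ones_def N_def by linarith
    have q: "q + T < 2 ^ w" unfolding q_def using tp by linarith
    have lq: "layout f (q + T) = f q" unfolding layout_def by simp
    have vB: "f q div N \<le> B" using div_le_mono[OF f[of q], of N] N_pos unfolding inft_def by simp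
    have vn: "v \<le> n" unfolding v_def using weight_le dn by simp
    define z where "z = (f q div N + v) * N + p mod N"
    have "f q div N + v + 1 \<le> 2 * B" using vB vn unfolding B_def by simp
    then have "(f q div N + v + 1) * N \<le> 2 * B * N" by (rule mult_le_mono1)
    then have "(f q div N + v) * N + N \<le> 2 * inft" unfolding inft_def by (simp add: algebra_simps)
    moreover have "p mod N < N" using N_pos by simp
    ultimately have z: "z < 2 * inft" "(f q div N + v) * N < 2 * inft" unfolding z_def by linarith+
    have "f q div N + v \<le> (f q div N + v) * N" using N_pos by simp
    then have bd: "f q div N + v < 2 ^ w" "(f q div N + v) * N < 2 ^ w" "z < 2 ^ w" "z + inft < 2 ^ w" "inft < 2 ^ w"
      using z value_bound by linarith+
    have mn: "x - (x - y) = min x y" for x y :: nat by simp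
    have ce: "cell f p = min (best f p m) (z + of_bool (\<not> matches p m) * inft)"
      unfolding cell_def z_def q_def v_def by simp
    have "vc w cell_post g M Q3"
      using that on q bd tp unfolding Q2_def Q3_def const_regs_def base_regs_def cell_post_def ce
      by (cases "matches p m") (simp_all add: q_def[symmetric] lq z_def[symmetric] mn layout_update)
    then show ?thesis by (rule runs_block) (simp add: cell_post_def)
  qed
  have "runs w cell_prog g (layout f) (13 + ((m * 20 + 1) + 18)) Q3"
    unfolding cell_prog_def by (rule runs_Seq[OF r1 runs_Seq[OF r2 r3]])
  then show ?thesis unfolding f_def
    by (rule runs_weaken) (auto simp: Q3_def f_def p_def c_def)
qed

definition outbase :: nat where "outbase = T + N + L * N"

definition pos :: "nat \<Rightarrow> nat \<Rightarrow> nat" where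
  "pos = trace (tab (L * N)) L (N - 1)"

definition out :: "nat \<Rightarrow> nat" where
  "out a = (if a div L = 0 then inp (n + 3 + pos 0 (a mod L)) else pos (a div L - 1) (a mod L))"

lemma trace_loop:
  assumes g: "const_regs g" "g 16 = x" "g 17 = y" "g 11 = l" "g 12 = m" "g 19 = outbase + l"
    and l: "l < L" and yp: "\<And>k. k < m \<Longrightarrow> dig y k - 1 = pos k l"
    and M: "\<And>a. a < outbase \<Longrightarrow> M a = layout f a"
      "\<And>a. a < (m + 1) * L \<Longrightarrow> l < a mod L \<or> a = l \<Longrightarrow> M (outbase + a) = out a"
  shows "runs w (WhileNZ 12 (block trace_step)) g M (m * 8 + 1)
    (\<lambda>g M. const_regs g \<and> g 16 = x \<and> g 11 = l \<and> (\<forall>a<outbase. M a = layout f a) \<and>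
       (\<forall>a<(m + 1) * L. l \<le> a mod L \<longrightarrow> M (outbase + a) = out a))"
proof -
  define I where "I j g M \<longleftrightarrow> const_regs g \<and> g 16 = x \<and> g 17 = y div B ^ j \<and> g 11 = l \<and> g 12 = m - j \<and>
      g 19 = outbase + (j * L + l) \<and> (\<forall>a<outbase. M a = layout f a) \<and>
      (\<forall>a<(m + 1) * L. l < a mod L \<or> a mod L = l \<and> a div L \<le> j \<longrightarrow> M (outbase + a) = out a)"
    for j g and M :: "nat \<Rightarrow> nat"
  have "runs w (WhileNZ 12 (block trace_step)) g M (m * (7 + 1) + 1) (I m)"
  proof (rule runs_While_count)
    have "a = l" if "a mod L = l" "a div L = 0" for a
      using that by (metis div_mult_mod_eq add_0 mult_0)
    then show "I 0 g M" using g M unfolding I_def by auto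
    show "g 12 = 0" if "I m g M" for g M using that unfolding I_def by simp
    fix j g M assume j: "j < m" and I: "I j g M"
    have "Suc j * L \<le> m * L" using j by (intro mult_le_mono1) simp
    then have "j * L + L \<le> m * L" by simp
    moreover have "m * L \<le> m * n" using L_le by simp
    ultimately have b: "outbase + (j * L + l) + L < 2 ^ w" "outbase + (j * L + l) < 2 ^ w"
      using table_bound l L_le unfolding outbase_def by linarith+
    have pd: "y div B ^ j mod B = dig y j" "y div B ^ j div B = y div (B * B ^ j)"
      unfolding dig_def by (auto simp: div_mult2_eq[symmetric] mult.commute)
    have od: "out (Suc j * L + l) = dig y j - 1"
    proof -
      have "(Suc j * L + l) div L = Suc j" using l by (subst div_mult_self3) auto
      moreover have "(Suc j * L + l) mod L = l" using l by (subst mod_mult_self3) auto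
      ultimately show ?thesis unfolding out_def yp[OF j] by simp
    qed
    define M' where "M' = M(outbase + (Suc j * L + l) := dig y j - 1)"
    have M'1: "\<forall>a<outbase. M' a = layout f a" using I unfolding M'_def I_def by auto
    have M'2: "M' (outbase + a) = out a"
      if a: "a < (m + 1) * L" "l < a mod L \<or> a mod L = l \<and> a div L \<le> Suc j" for a
    proof (cases "a = Suc j * L + l")
      case True
      then show ?thesis unfolding M'_def using od by simp
    next
      case False
      then have "\<not> (a mod L = l \<and> a div L = Suc j)" by (metis div_mult_mod_eq)
      then have "l < a mod L \<or> a mod L = l \<and> a div L \<le> j" using a(2) by auto
      then show ?thesis using I a(1) False unfolding I_def M'_def by auto
    qed
    have "vc w trace_step g M (\<lambda>g M. M = M' \<and> const_regs g \<and> g 16 = x \<and> g 17 = y div B ^ Suc j \<and>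
        g 11 = l \<and> g 12 = m - Suc j \<and> g 19 = outbase + (Suc j * L + l))"
      using I b(1) unfolding I_def trace_step_def const_regs_def base_regs_def M'_def
      by (simp add: pd add.assoc add.left_commute add.commute)
    then have "runs w (block trace_step) g M 7 (\<lambda>g M. M = M' \<and> const_regs g \<and> g 16 = x \<and>
        g 17 = y div B ^ Suc j \<and> g 11 = l \<and> g 12 = m - Suc j \<and> g 19 = outbase + (Suc j * L + l))"
      by (rule runs_block) (simp add: trace_step_def)
    then have "runs w (block trace_step) g M 7 (I (Suc j))"
      by (rule runs_weaken) (use M'1 M'2 in \<open>auto simp: I_def\<close>)
    then show "g 12 \<noteq> 0 \<and> runs w (block trace_step) g M 7 (I (Suc j))"
      using I j unfolding I_def by simp
  qed
  moreover have "a div L \<le> m" if "a < (m + 1) * L" for a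
    using less_mult_imp_div_less[OF that] by simp
  ultimately show ?thesis by (elim runs_weaken) (auto simp: I_def le_less)
qed

lemma trace_body:
  assumes g: "const_regs g" "g 16 = x" "g 11 = Suc l" and l: "l < L" and x: "x < N"
    and tr: "\<And>k j. j < Suc l \<Longrightarrow> trace (tab (L * N)) (Suc l) x k j = pos k j"
    and M: "\<And>a. a < outbase \<Longrightarrow> M a = layout (tab (L * N)) a"
      "\<And>a. a < (m + 1) * L \<Longrightarrow> Suc l \<le> a mod L \<Longrightarrow> M (outbase + a) = out a"
  shows "runs w trace_prog g M (m * 8 + 17)
    (\<lambda>g M. \<exists>x<N. const_regs g \<and> g 16 = x \<and> g 11 = l \<and>
       (\<forall>k. \<forall>j<l. trace (tab (L * N)) l x k j = pos k j) \<and>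
       (\<forall>a<outbase. M a = layout (tab (L * N)) a) \<and>
       (\<forall>a<(m + 1) * L. l \<le> a mod L \<longrightarrow> M (outbase + a) = out a))"
proof -
  define f where "f = tab (L * N)"
  define y where "y = f (Suc l * N + x) mod N"
  have y: "y < N" unfolding y_def using N_pos by simp
  have dl: "dig y k - 1 = pos k l" for k
    using tr[of l k] unfolding y_def f_def by (simp add: Let_def)
  have tr': "trace (tab (L * N)) l (y - ones) k j = pos k j" if "j < l" for k j
    using tr[of j k] that unfolding y_def f_def by (simp add: Let_def)
  have lN: "Suc l * N \<le> L * N" using l by (intro mult_le_mono1) simp
  have ad: "Suc l * N + x + T < outbase" using lN x unfolding outbase_def by linarith
  have ob: "outbase + l < 2 ^ w" using table_bound l L_le unfolding outbase_def by simp
  have bd: "Suc l * N < 2 ^ w" "Suc l * N + x < 2 ^ w" "Suc l * N + x + T < 2 ^ w"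
    using ad ob by linarith+
  have ly: "M (Suc l * N + x + T) = f (Suc l * N + x)"
    using M(1)[OF ad] unfolding layout_def f_def by simp
  have d0: "y mod B - 1 = pos 0 l" using dl[of 0] unfolding dig_def by simp
  have "y mod B < B" using B_pos by simp
  then have "pos 0 l < n" unfolding d0[symmetric] using n_pos unfolding B_def by linarith
  moreover have "n \<le> m * n" using m_pos by simp
  ultimately have pa: "pos 0 l + (n + 2) + 1 < T" unfolding T_def by linarith
  have To: "T \<le> outbase" unfolding outbase_def by simp
  then have pw: "pos 0 l + (n + 2) < 2 ^ w" "pos 0 l + (n + 2) + 1 < 2 ^ w" using pa ob by linarith+
  have lc: "M (pos 0 l + (n + 2) + 1) = inp (n + 3 + pos 0 l)"
  proof -
    have "pos 0 l + (n + 2) + 1 = n + 3 + pos 0 l" by simp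
    then show ?thesis using M(1)[of "n + 3 + pos 0 l"] pa To unfolding layout_def by (metis less_le_trans)
  qed
  define M' where "M' = M(outbase + l := inp (n + 3 + pos 0 l))"
  have ol: "out l = inp (n + 3 + pos 0 l)" unfolding out_def using l by simp
  define Q1 where "Q1 g M \<longleftrightarrow> M = M' \<and> const_regs g \<and> g 16 = y - ones \<and> g 17 = y \<and> g 11 = l \<and> g 12 = m \<and>
    g 19 = outbase + l" for g M
  have "vc w trace_pre g M Q1"
    using g bd pw ob unfolding Q1_def trace_pre_def const_regs_def base_regs_def
    by (simp add: ly[simplified] y_def[simplified, symmetric] d0[simplified] lc[simplified] M'_def outbase_def)
  then have r1: "runs w (block trace_pre) g M 16 Q1"
    by (rule runs_block) (simp add: trace_pre_def)
  have M'1: "M' a = layout f a" if "a < outbase" for a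
    using M(1) that unfolding M'_def f_def by simp
  have M'2: "M' (outbase + a) = out a" if "a < (m + 1) * L" "l < a mod L \<or> a = l" for a
    using M(2) that ol unfolding M'_def by auto
  have r2: "runs w (WhileNZ 12 (block trace_step)) g M (m * 8 + 1)
    (\<lambda>g M. const_regs g \<and> g 16 = y - ones \<and> g 11 = l \<and> (\<forall>a<outbase. M a = layout f a) \<and>
       (\<forall>a<(m + 1) * L. l \<le> a mod L \<longrightarrow> M (outbase + a) = out a))" if "Q1 g M" for g M
    using that trace_loop[of g "y - ones" y l M f, OF _ _ _ _ _ _ l dl] M'1 M'2 unfolding Q1_def by blast
  have "runs w trace_prog g M (16 + (m * 8 + 1))
    (\<lambda>g M. const_regs g \<and> g 16 = y - ones \<and> g 11 = l \<and> (\<forall>a<outbase. M a = layout f a) \<and>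
       (\<forall>a<(m + 1) * L. l \<le> a mod L \<longrightarrow> M (outbase + a) = out a))"
    unfolding trace_prog_def by (rule runs_Seq[OF r1 r2])
  then show ?thesis
  proof (rule runs_weaken)
    have "y - ones < N" using y by simp
    then show "\<exists>x<N. const_regs g \<and> g 16 = x \<and> g 11 = l \<and>
       (\<forall>k. \<forall>j<l. trace (tab (L * N)) l x k j = pos k j) \<and>
       (\<forall>a<outbase. M a = layout (tab (L * N)) a) \<and>
       (\<forall>a<(m + 1) * L. l \<le> a mod L \<longrightarrow> M (outbase + a) = out a)"
      if "const_regs g \<and> g 16 = y - ones \<and> g 11 = l \<and> (\<forall>a<outbase. M a = layout f a) \<and>
       (\<forall>a<(m + 1) * L. l \<le> a mod L \<longrightarrow> M (outbase + a) = out a)" for g M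
      using that tr' unfolding f_def by blast
  qed simp
qed

lemma alignment_prog_runs:
  "runs w alignment_prog g (layout (\<lambda>_. 0))
     (29 + m * 5 + L * N * (m * 20 + 41) + L * (m * 8 + 18))
     (\<lambda>g M. g 0 = L \<and> g 1 = outbase \<and> (\<forall>a<(m + 1) * L. M (outbase + a) = out a))"
proof -
  define M0 where "M0 = layout (\<lambda>_. 0)"
  define Q1 where "Q1 g M \<longleftrightarrow> base_regs g \<and> g 5 = 1 \<and> g 6 = 0 \<and> g 12 = m \<and> M = M0" for g M
  have ld: "M0 0 = m" "M0 1 = n" "n - M0 2 = L"
    unfolding M0_def layout_def T_def using header by auto
  have "vc w setup_code g M0 Q1"
    using small_bounds unfolding setup_code_def Q1_def base_regs_def
    by (simp add: ld[simplified] ld(3)[unfolded numeral_2_eq_2] B_def T_def add.commute add.left_commute)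
  then have r1: "runs w (block setup_code) g M0 17 Q1"
    by (rule runs_block) (simp add: setup_code_def)
  define Q2 where "Q2 g M \<longleftrightarrow> base_regs g \<and> g 5 = N \<and> g 6 = ones \<and> M = M0" for g M
  have r2: "runs w (WhileNZ 12 (block power_code)) g M (m * 5 + 1) Q2" if "Q1 g M" for g M
    using power_loop[of g "\<lambda>M. M = M0" M] that unfolding Q1_def Q2_def by auto
  define I where "I i g M \<longleftrightarrow> const_regs g \<and> g 16 = N + i \<and> g 11 = L * N - i \<and> M = layout (tab i)" for i g M
  have r3: "runs w (block start_code) g M 6 (I 0)" if "Q2 g M" for g M
  proof -
    have "B * N < 2 ^ w" using value_bound unfolding inft_def by simp
    then have "vc w start_code g M (I 0)"
      using that table_bound unfolding start_code_def Q2_def I_def const_regs_def base_regs_def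
      by (simp add: inft_def M0_def)
    then show ?thesis by (rule runs_block) (simp add: start_code_def)
  qed
  have r4: "runs w (WhileNZ 11 cell_prog) g M (L * N * (m * 20 + 40 + 1) + 1) (I (L * N))" if "I 0 g M" for g M
  proof (rule runs_While_count[where I = I, OF that])
    show "g 11 \<noteq> 0 \<and> runs w cell_prog g M (m * 20 + 40) (I (Suc i))" if "i < L * N" "I i g M" for i g M
      using cell_body[of g i] that unfolding I_def by simp
  qed (simp add: I_def)
  define f where "f = tab (L * N)"
  define J where "J i g M \<longleftrightarrow> (\<exists>x<N. const_regs g \<and> g 16 = x \<and> g 11 = L - i \<and>
       (\<forall>k. \<forall>j<L - i. trace f (L - i) x k j = pos k j) \<and>
       (\<forall>a<outbase. M a = layout f a) \<and>
       (\<forall>a<(m + 1) * L. L - i \<le> a mod L \<longrightarrow> M (outbase + a) = out a))"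
    for i g and M :: "nat \<Rightarrow> nat"
  have r5: "runs w (block trace_start) g M 3 (J 0)" if "I (L * N) g M" for g M
  proof -
    have "a mod L < L" if "a < (m + 1) * L" for a
      using that by (cases "L = 0") auto
    then have "\<forall>a<(m + 1) * L. L \<le> a mod L \<longrightarrow> M (outbase + a) = out a"
      by (meson not_less)
    then have "vc w trace_start g M (J 0)"
      using that N_pos unfolding trace_start_def J_def I_def const_regs_def base_regs_def
      by (simp add: f_def pos_def)
    then show ?thesis by (rule runs_block) (simp add: trace_start_def)
  qed
  have r6: "runs w (WhileNZ 11 trace_prog) g M (L * (m * 8 + 17 + 1) + 1) (J L)" if "J 0 g M" for g M
  proof (rule runs_While_count[where I = J, OF that])
    fix i g M assume i: "i < L" and J: "J i g M"
    define l where "l = L - Suc i"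
    have l: "L - i = Suc l" "l < L" using i unfolding l_def by auto
    show "g 11 \<noteq> 0 \<and> runs w trace_prog g M (m * 8 + 17) (J (Suc i))"
      using J trace_body[of g _ l M] l(2) unfolding J_def l(1) l_def[symmetric] f_def by auto
  qed (auto simp: J_def)
  have "runs w alignment_prog g M0
    (17 + ((m * 5 + 1) + (6 + ((L * N * (m * 20 + 40 + 1) + 1) + (3 + (L * (m * 8 + 17 + 1) + 1)))))) (J L)"
    unfolding alignment_prog_def
    by (rule runs_Seq[OF r1 runs_Seq[OF r2 runs_Seq[OF r3 runs_Seq[OF r4 runs_Seq[OF r5 r6]]]]])
  then show ?thesis unfolding M0_def
    by (rule runs_weaken)
      (simp add: algebra_simps, auto simp: J_def const_regs_def base_regs_def outbase_def)
qed

end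


section \<open>Optimality of the computed alignment\<close>

lemma concat_map_upt:
  "concat (map (\<lambda>k. map (h k) [0..<L]) [0..<m]) = map (\<lambda>a. h (a div L) (a mod L)) [0..<m * L]"
proof (induction m)
  case (Suc m)
  have "[0..<Suc m * L] = [0..<m * L] @ [m * L..<m * L + L]"
    using upt_add_eq_append[of 0 "m * L" L] by (simp add: add.commute)
  moreover have "map (\<lambda>a. h (a div L) (a mod L)) [m * L..<m * L + L] = map (h m) [0..<L]"
    by (rule nth_equalityI) auto
  ultimately show ?case using Suc by simp
qed simp

lemma nth_concat_uniform:
  assumes "\<forall>s\<in>set ss. length s = n" "k < length ss" "i < n"
  shows "concat ss ! (k * n + i) = ss ! k ! i"
  using assms
proof (induction ss arbitrary: k)
  case (Cons s ss)
  then show ?case by (cases k) (auto simp: nth_append)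
qed simp

lemma length_concat_uniform: "\<forall>s\<in>set ss. length s = n \<Longrightarrow> length (concat ss) = length ss * n"
  by (induction ss) auto

lemma embedding_range:
  assumes "embedding t s e"
  shows "set e \<subseteq> {..<length s}" "card (set e) = length t"
proof -
  show "set e \<subseteq> {..<length s}"
    using assms unfolding embedding_def by (auto simp: in_set_conv_nth)
  have "distinct e" using assms unfolding embedding_def by (auto simp: strict_sorted_iff)
  then show "card (set e) = length t"
    using assms unfolding embedding_def by (simp add: distinct_card)
qed

lemma alignment_cost_eq:
  assumes "common_alignment ss \<sigma>" "\<forall>s\<in>set ss. length s = n"
  shows "alignment_cost ss \<sigma> = length ss * (n - length (fst \<sigma>))"
proof -
  have "card (unaligned ss \<sigma> k) = n - length (fst \<sigma>)" if "k < length ss" for k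
  proof -
    have "embedding (fst \<sigma>) (ss ! k) (snd \<sigma> ! k)" "length (ss ! k) = n"
      using assms that unfolding common_alignment_def by auto
    then show ?thesis
      unfolding unaligned_def aligned_def using embedding_range by (metis card_Diff_subset card_lessThan finite_set)
  qed
  then show ?thesis unfolding alignment_cost_def by simp
qed

lemma card_unaligned_Int:
  assumes "S \<subseteq> {..<length (ss ! 0)}"
  shows "card (unaligned ss \<sigma> 0 \<inter> S) = card S - card (aligned \<sigma> 0 \<inter> S)"
proof -
  have "unaligned ss \<sigma> 0 \<inter> S = S - aligned \<sigma> 0 \<inter> S"
    using assms unfolding unaligned_def by auto
  moreover have "finite S" using assms finite_subset by blast
  ultimately show ?thesis by (simp add: card_Diff_subset)
qed

lemma (in alignment_table) dig_max:
  assumes "k < m"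
  shows "dig (N - 1) k = n"
proof -
  define c where "c = B ^ (m - Suc k)"
  have c: "0 < c" unfolding c_def using B_pos by simp
  have "m = k + Suc (m - Suc k)" using assms by simp
  then have e: "N = (B * c) * B ^ k" unfolding N_def c_def by (metis power_Suc power_add mult.commute)
  have pk: "0 < B ^ k" using B_pos by simp
  obtain c' where c': "c = Suc c'" using c gr0_implies_Suc by blast
  obtain b where b: "B ^ k = Suc b" using pk gr0_implies_Suc by blast
  have "N = (B * c' + n) * B ^ k + B ^ k"
    unfolding e c' by (simp add: B_def algebra_simps)
  then have "N - 1 = (B * c' + n) * B ^ k + b" using b by simp
  moreover have "b < B ^ k" using b by simp
  ultimately have "(N - 1) div B ^ k = B * c' + n" by (metis div_less div_mult_self3 add.right_neutral less_nat_zero_code)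
  then have "dig (N - 1) k = (n + B * c') mod B" unfolding dig_def by (simp add: add.commute)
  also have "\<dots> = n" unfolding mod_mult_self2 by (simp add: B_def)
  finally show ?thesis .
qed

locale alignment_instance = alignment_run +
  fixes ss :: "nat list list" and S :: "nat set" and d :: nat
  assumes len_ss: "length ss = m" and len_s: "\<forall>s\<in>set ss. length s = n"
    and S: "S \<subseteq> {..<n}" and L: "L = n - d"
    and inp_S: "\<And>i. i < n \<Longrightarrow> inp (3 + i) = of_bool (i \<in> S)"
    and inp_ss: "\<And>k i. k < m \<Longrightarrow> i < n \<Longrightarrow> chr k i = ss ! k ! i"
begin

definition \<sigma>_opt :: "nat alignment" where
  "\<sigma>_opt = (map (\<lambda>j. chr 0 (pos 0 j)) [0..<L], map (\<lambda>k. map (pos k) [0..<L]) [0..<m])"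

lemma weight_eq:
  assumes "ali l (\<lambda>_. n) e"
  shows "weight l e = card (e 0 ` {..<l} \<inter> S)"
proof -
  have m0: "0 < m" using m_pos by simp
  have "weight l e = (\<Sum>j<l. of_bool (e 0 j \<in> S))"
    unfolding weight_def using inp_S aliD(2)[OF assms m0] by (intro sum.cong) auto
  also have "\<dots> = card {j \<in> {..<l}. e 0 j \<in> S}"
    by (simp add: Int_def flip: Collect_conj_eq)
  also have "\<dots> = card (e 0 ` {j \<in> {..<l}. e 0 j \<in> S})"
  proof (rule card_image[symmetric], rule inj_onI)
    fix x y assume "x \<in> {j \<in> {..<l}. e 0 j \<in> S}" "y \<in> {j \<in> {..<l}. e 0 j \<in> S}" "e 0 x = e 0 y"
    then show "x = y"
      using ali_strict_mono[OF assms m0, of x y] ali_strict_mono[OF assms m0, of y x]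
      by (metis (mono_tags, lifting) less_irrefl lessThan_iff linorder_neqE_nat mem_Collect_eq)
  qed
  also have "e 0 ` {j \<in> {..<l}. e 0 j \<in> S} = e 0 ` {..<l} \<inter> S" by auto
  finally show ?thesis .
qed

lemma feasible_iff:
  assumes "common_alignment ss \<sigma>"
  shows "alignment_cost ss \<sigma> \<le> d * m \<longleftrightarrow> L \<le> length (fst \<sigma>)"
  using alignment_cost_eq[OF assms len_s] m_pos unfolding len_ss L by (simp add: mult.commute) linarith

lemma ali_of_alignment:
  assumes "common_alignment ss \<sigma>" "L \<le> length (fst \<sigma>)"
  defines "e \<equiv> \<lambda>k j. snd \<sigma> ! k ! j"
  shows "ali L (\<lambda>_. n) e" "weight L e \<le> card (aligned \<sigma> 0 \<inter> S)"
proof -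
  have emb: "embedding (fst \<sigma>) (ss ! k) (snd \<sigma> ! k)" if "k < m" for k
    using assms(1) len_ss that unfolding common_alignment_def by auto
  have lk: "length (ss ! k) = n" if "k < m" for k using len_s len_ss that by simp
  have e: "e k j < n" "ss ! k ! e k j = fst \<sigma> ! j" if "k < m" "j < L" for k j
    using emb[OF that(1)] lk[OF that(1)] that(2) assms(2) unfolding embedding_def e_def by auto
  show al: "ali L (\<lambda>_. n) e"
  proof (rule aliI)
    fix k j assume k: "k < m"
    show "e k j < e k (Suc j)" if "Suc j < L"
      using emb[OF k] that assms(2) unfolding embedding_def e_def by (auto simp: sorted_wrt_iff_nth_less)
    show "e k j < n" if "j < L" using e k that by simp
    have "0 < m" using m_pos by simp
    then show "chr k (e k j) = chr 0 (e 0 j)" if "j < L"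
      using inp_ss e k that by metis
  qed
  have "0 < m" using m_pos by simp
  then have "e 0 ` {..<L} \<subseteq> aligned \<sigma> 0"
    using emb[of 0] assms(2) unfolding aligned_def e_def embedding_def by auto
  then have "card (e 0 ` {..<L} \<inter> S) \<le> card (aligned \<sigma> 0 \<inter> S)"
    unfolding aligned_def by (intro card_mono) auto
  then show "weight L e \<le> card (aligned \<sigma> 0 \<inter> S)" using weight_eq[OF al] by simp
qed

lemma \<sigma>_opt_alignment:
  assumes "ali L (\<lambda>_. n) pos"
  shows "common_alignment ss \<sigma>_opt" "card (aligned \<sigma>_opt 0 \<inter> S) = weight L pos"
proof -
  have "embedding (fst \<sigma>_opt) (ss ! k) (snd \<sigma>_opt ! k)" if k: "k < m" for k
  proof -
    have lk: "length (ss ! k) = n" using len_s len_ss k by simp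
    have "ss ! k ! pos k j = chr 0 (pos 0 j)" if "j < L" for j
      using inp_ss[OF k aliD(2)[OF assms k that]] aliD(3)[OF assms k that] by simp
    then show ?thesis
      using ali_strict_mono[OF assms k] aliD(2)[OF assms k] lk k
      unfolding embedding_def \<sigma>_opt_def by (auto simp: sorted_wrt_iff_nth_less)
  qed
  then show "common_alignment ss \<sigma>_opt"
    unfolding common_alignment_def len_ss by (simp add: \<sigma>_opt_def)
  have "aligned \<sigma>_opt 0 = pos 0 ` {..<L}"
    using m_pos unfolding aligned_def \<sigma>_opt_def by (simp add: lessThan_atLeast0)
  then show "card (aligned \<sigma>_opt 0 \<inter> S) = weight L pos"
    using weight_eq[OF assms] by simp
qed

lemma \<sigma>_opt_optimal:
  assumes "common_alignment ss \<sigma>0" "alignment_cost ss \<sigma>0 \<le> d * m"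
  shows "is_arg_max (\<lambda>\<sigma>. card (unaligned ss \<sigma> 0 \<inter> S))
    (\<lambda>\<sigma>. common_alignment ss \<sigma> \<and> alignment_cost ss \<sigma> \<le> d * m) \<sigma>_opt"
proof -
  define p where "p = L * N + (N - 1)"
  have p: "p < N + L * N" "p div N = L"
    unfolding p_def using N_pos by (simp, subst div_mult_self3) auto
  have dp: "dig p k = n" if "k < m" for k
    unfolding p_def dig_layer[OF that] using dig_max[OF that] .
  have lower: "tab (L * N) p div N \<le> weight L e" if "ali L (\<lambda>_. n) e" for e
  proof -
    have "ali L (dig p) e"
      by (rule ali_weaken[OF that]) (use dp aliD(2)[OF that] in auto)
    then show ?thesis using tab_lower_bound[OF p(1)] p(2) by simp
  qed
  have lower': "tab (L * N) p div N \<le> card (aligned \<sigma> 0 \<inter> S)"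
    if "common_alignment ss \<sigma>" "alignment_cost ss \<sigma> \<le> d * m" for \<sigma>
    using ali_of_alignment[OF that(1)] feasible_iff[OF that(1)] that(2) lower by (meson order_trans)
  have "card (aligned \<sigma>0 0 \<inter> S) \<le> card {..<n}" using S by (intro card_mono) auto
  then have "tab (L * N) p div N < B" using lower'[OF assms] unfolding B_def by simp
  then have "tab (L * N) (L * N + (N - 1)) < inft"
    unfolding inft_def p_def using N_pos by (simp add: div_less_iff_less_mult)
  then have tr: "ali L (dig (N - 1)) pos" "tab (L * N) p div N = weight L pos"
    using trace_correct[of L "L * N" "N - 1"] N_pos unfolding pos_def p_def by auto
  have al: "ali L (\<lambda>_. n) pos"
    by (rule ali_weaken[OF tr(1)]) (use dig_max aliD(2)[OF tr(1)] in auto)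
  note opt = \<sigma>_opt_alignment[OF al]
  have "alignment_cost ss \<sigma>_opt \<le> d * m"
    unfolding feasible_iff[OF opt(1)] by (simp add: \<sigma>_opt_def)
  moreover have "card (unaligned ss \<sigma> 0 \<inter> S) \<le> card (unaligned ss \<sigma>_opt 0 \<inter> S)"
    if "common_alignment ss \<sigma>" "alignment_cost ss \<sigma> \<le> d * m" for \<sigma>
  proof -
    have "0 < length ss" using len_ss m_pos by simp
    then have "S \<subseteq> {..<length (ss ! 0)}" using len_s S by auto
    then show ?thesis
      using card_unaligned_Int[of S ss] lower'[OF that] tr(2) opt(2) by simp
  qed
  ultimately show ?thesis unfolding is_arg_max_def using opt(1) by (auto simp: not_less)
qed

lemma outputs_\<sigma>_opt:
  assumes "g 0 = L" "g 1 = outbase" "\<forall>a<(m + 1) * L. M (outbase + a) = out a"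
  shows "outputs \<lparr>reg = g, mem = M\<rparr> \<sigma>_opt"
proof -
  define h where "h k j = (if k = 0 then chr 0 (pos 0 j) else pos (k - 1) j)" for k j
  have "fst \<sigma>_opt @ concat (snd \<sigma>_opt) = concat (map (\<lambda>k. map (h k) [0..<L]) (0 # map Suc [0..<m]))"
    unfolding \<sigma>_opt_def h_def by (simp add: comp_def)
  also have "0 # map Suc [0..<m] = [0..<m + 1]"
    unfolding map_Suc_upt by (simp add: upt_conv_Cons)
  also have "concat (map (\<lambda>k. map (h k) [0..<L]) [0..<m + 1]) = map out [0..<(m + 1) * L]"
    unfolding concat_map_upt by (auto simp: out_def h_def chr_def)
  finally have xs: "fst \<sigma>_opt @ concat (snd \<sigma>_opt) = map out [0..<(m + 1) * L]" .
  have "map M [outbase..<outbase + (m + 1) * L] = map out [0..<(m + 1) * L]"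
    by (rule nth_equalityI) (use assms(3) in auto)
  then show ?thesis
    unfolding outputs_def Let_def xs using assms(1,2) by (simp add: \<sigma>_opt_def)
qed

end

lemma power_bounds:
  fixes m n :: nat
  assumes "1 \<le> m" "1 \<le> n"
  defines "X \<equiv> 2 ^ m * m * n ^ (m + 1)"
  shows "n * (n + 1) ^ m * m \<le> X" "(n + 1) * (n + 1) ^ m \<le> 2 * X" "m * n \<le> X" "2 \<le> X"
proof -
  have "(n + 1) ^ m \<le> (2 * n) ^ m" using assms(2) by (intro power_mono) auto
  then have N: "(n + 1) ^ m \<le> 2 ^ m * n ^ m" by (simp add: power_mult_distrib)
  have "n * (n + 1) ^ m * m \<le> n * (2 ^ m * n ^ m) * m" using N by simp
  then show 1: "n * (n + 1) ^ m * m \<le> X" unfolding X_def by (simp add: mult_ac)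
  have "(n + 1) * (n + 1) ^ m \<le> (2 * n) * (n + 1) ^ m" using assms(2) by (intro mult_le_mono1) simp
  also have "\<dots> \<le> 2 * (n * (n + 1) ^ m * m)" using assms(1) by simp
  finally show "(n + 1) * (n + 1) ^ m \<le> 2 * X" using 1 by linarith
  have "n * m \<le> n * (n + 1) ^ m * m" by (intro mult_le_mono1) simp
  then show "m * n \<le> X" using 1 by (metis mult.commute order_trans)
  have "2 * 1 * 1 \<le> 2 ^ m * m * n ^ (m + 1)"
    using assms by (intro mult_le_mono) (auto simp: self_le_power)
  then show "2 \<le> X" unfolding X_def by simp
qed

lemma word_length_bound:
  fixes X w :: nat
  assumes "2 \<le> X" "8 * log 2 (real X) \<le> real w"
  shows "128 * X \<le> 2 ^ w"
proof -
  have "2 powr (8 * log 2 (real X)) = (2 powr log 2 (real X)) powr 8"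
    by (simp add: powr_powr mult.commute)
  also have "\<dots> = real X ^ 8" using assms(1) by simp
  finally have "real X ^ 8 = 2 powr (8 * log 2 (real X))" by simp
  also have "\<dots> \<le> 2 powr real w" using assms(2) by simp
  also have "\<dots> = real (2 ^ w)" by (simp add: powr_realpow)
  finally have "real (X ^ 8) \<le> real (2 ^ w)" by simp
  then have "X ^ 8 \<le> 2 ^ w" by (metis of_nat_le_iff)
  moreover have "2 ^ 7 * X \<le> X ^ 7 * X" using assms(1) by (intro mult_le_mono1 power_mono) auto
  then have "128 * X \<le> X ^ 8" by (simp add: eval_nat_numeral mult_ac)
  ultimately show ?thesis by linarith
qed

theorem theorem5:
  "\<exists>(P :: com) (C :: real) (c :: nat) (K :: real).
     \<forall>(m :: nat) (n :: nat) (ss :: nat list list) (S :: nat set) (d :: nat) (w :: nat).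
       m \<ge> 1 \<longrightarrow> n \<ge> 1 \<longrightarrow>
       length ss = m \<longrightarrow> (\<forall>s\<in>set ss. length s = n) \<longrightarrow>
       S \<subseteq> {..<n} \<longrightarrow> d \<le> n \<longrightarrow>
       (\<forall>s\<in>set ss. \<forall>a\<in>set s. a < 2 ^ w) \<longrightarrow>
       real w \<ge> K * log 2 (2 ^ m * real m * real n ^ (m + 1)) \<longrightarrow>
       (\<exists>t st.
          exec w P (input_state n ss S d) t st \<and>
          real t \<le> C * (2 ^ m * real m * real n ^ (m + 1)) * log 2 (real n + 1) ^ c \<and>
          ((\<exists>\<sigma>. common_alignment ss \<sigma> \<and> alignment_cost ss \<sigma> \<le> d * m) \<longrightarrow>
           (\<exists>\<sigma>. outputs st \<sigma> \<and>
                is_arg_max (\<lambda>\<sigma>. card (unaligned ss \<sigma> 0 \<inter> S))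
                  (\<lambda>\<sigma>. common_alignment ss \<sigma> \<and> alignment_cost ss \<sigma> \<le> d * m) \<sigma>)))"
proof (rule exI[of _ alignment_prog], rule exI[of _ 121], rule exI[of _ 0], rule exI[of _ 8], intro allI impI)
  fix m n :: nat and ss :: "nat list list" and S :: "nat set" and d w :: nat
  assume m: "1 \<le> m" and n: "1 \<le> n" and len: "length ss = m" "\<forall>s\<in>set ss. length s = n"
    and S: "S \<subseteq> {..<n}" and d: "d \<le> n"
    and w: "8 * log 2 (2 ^ m * real m * real n ^ (m + 1)) \<le> real w"
  define X where "X = 2 ^ m * m * n ^ (m + 1)"
  have rX: "2 ^ m * real m * real n ^ (m + 1) = real X" unfolding X_def by simp
  note pb = power_bounds[OF m n, folded X_def]
  have wX: "128 * X \<le> 2 ^ w" using word_length_bound[OF pb(4)] w unfolding rX by simp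
  define xs where "xs = input_words n ss S d"
  define inp where "inp a = (if a < length xs then xs ! a else 0)" for a
  have lxs: "length xs = 3 + n + m * n"
    unfolding xs_def input_words_def using length_concat_uniform[OF len(2)] len(1) by simp
  have hd: "inp 0 = m" "inp 1 = n" "inp 2 = d"
    unfolding inp_def lxs unfolding xs_def input_words_def using len by auto
  have inS: "inp (3 + i) = of_bool (i \<in> S)" if "i < n" for i
    unfolding inp_def lxs unfolding xs_def input_words_def using that by (simp add: nth_append)
  have inss: "inp (n + 3 + k * n + i) = ss ! k ! i" if "k < m" "i < n" for k i
  proof -
    have "Suc k * n \<le> m * n" using that by (intro mult_le_mono1) simp
    then have "n + 3 + k * n + i < length xs" unfolding lxs using that by simp
    moreover have "xs ! (n + 3 + k * n + i) = concat ss ! (k * n + i)"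
      unfolding xs_def input_words_def by (simp add: nth_append)
    ultimately show ?thesis
      unfolding inp_def using nth_concat_uniform[OF len(2)] that len(1) by simp
  qed
  interpret alignment_table m n inp
  proof
    show "inp (2 + i) \<le> n" if "i \<le> n" for i
    proof (cases i)
      case 0
      then show ?thesis using hd d by simp
    next
      case (Suc j)
      then have "inp (2 + i) = inp (3 + j)" by (simp add: numeral_3_eq_3 numeral_2_eq_2)
      then show ?thesis using inS[of j] that Suc n by simp
    qed
  qed (fact m n)+
  define L where "L = n - d"
  have BN: "B = n + 1" "N = (n + 1) ^ m" unfolding N_def B_def by auto
  have LN: "L * N \<le> n * N" unfolding L_def by simp
  have nNm: "n * N * m \<le> X" using pb(1) unfolding BN .
  have "n * N \<le> n * N * m" using m by simp
  then have nN: "n * N \<le> X" using nNm by linarith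
  have "N \<le> n * N" using n by simp
  then have N: "N \<le> X" using nN by linarith
  have "n \<le> m * n" using m by simp
  then have nX: "n \<le> X" using pb(3) by linarith
  interpret alignment_instance m n inp L w ss S d
  proof
    have "(m + 2) * n = m * n + 2 * n" by (simp add: algebra_simps)
    then show "3 + n + m * n + N + L * N + (m + 2) * n < 2 ^ w"
      using wX pb(3,4) LN nN N nX by linarith
    show "3 * inft < 2 ^ w" using pb(2,4) wX unfolding inft_def BN by linarith
  qed (use hd len S inS inss in \<open>auto simp: L_def chr_def\<close>)
  have "layout (\<lambda>_. 0) a = inp a" for a
    unfolding layout_def T_def by (simp add: inp_def lxs)
  then have "layout (\<lambda>_. 0) = inp" by (rule ext)
  then have st: "input_state n ss S d = \<lparr>reg = \<lambda>_. 0, mem = layout (\<lambda>_. 0)\<rparr>"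
    unfolding input_state_def Let_def inp_def xs_def by simp
  obtain t g M where ex: "exec w alignment_prog (input_state n ss S d) t \<lparr>reg = g, mem = M\<rparr>"
    and t: "t \<le> 29 + m * 5 + L * N * (m * 20 + 41) + L * (m * 8 + 18)"
    and out: "g 0 = L" "g 1 = outbase" "\<forall>a<(m + 1) * L. M (outbase + a) = out a"
    using alignment_prog_runs[of "\<lambda>_. 0"] unfolding runs_def st by blast
  have "t \<le> 121 * X"
  proof -
    have "L * N * (m * 20 + 41) \<le> n * N * (61 * m)" using m by (intro mult_le_mono LN) simp
    also have "\<dots> = 61 * (n * N * m)" by simp
    finally have 1: "L * N * (m * 20 + 41) \<le> 61 * X" using nNm by linarith
    have "L * (m * 8 + 18) \<le> n * (26 * m)" unfolding L_def using m by (intro mult_le_mono) auto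
    also have "\<dots> = 26 * (m * n)" by simp
    finally have 2: "L * (m * 8 + 18) \<le> 26 * X" using pb(3) by linarith
    have "m \<le> m * n" using n by simp
    then have "m \<le> X" using pb(3) by linarith
    then show ?thesis using t 1 2 pb(4) by linarith
  qed
  then have "real t \<le> 121 * real X" by linarith
  then show "\<exists>t st. exec w alignment_prog (input_state n ss S d) t st \<and>
      real t \<le> 121 * (2 ^ m * real m * real n ^ (m + 1)) * log 2 (real n + 1) ^ 0 \<and>
      ((\<exists>\<sigma>. common_alignment ss \<sigma> \<and> alignment_cost ss \<sigma> \<le> d * m) \<longrightarrow>
       (\<exists>\<sigma>. outputs st \<sigma> \<and> is_arg_max (\<lambda>\<sigma>. card (unaligned ss \<sigma> 0 \<inter> S))
          (\<lambda>\<sigma>. common_alignment ss \<sigma> \<and> alignment_cost ss \<sigma> \<le> d * m) \<sigma>))"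
    using ex outputs_\<sigma>_opt[OF out] \<sigma>_opt_optimal unfolding rX power_0 mult_1_right by blast
qed

end
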